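(* If $G$ is a $(P_5,\text{banner})$-free graph, then $$\chi(G)\leq \left\lceil\frac{\Delta(G)+\omega(G)+1}{2}\right\rceil.$$
   Context: All graphs are finite, simple and undirected (with at least one vertex). $\chi(G)$, $\omega(G)$ and $\Delta(G)$ are the chromatic number, the clique number and the maximum degree of $G$. $P_5$ is the path on 5 vertices; the banner is the 5-vertex graph obtained from the cycle $C_4$ by adding one new vertex adjacent to exactly one vertex of the $C_4$. $G$ is $(P_5,\text{banner})$-free if it has no induced subgraph isomorphic to $P_5$ or to the banner. *)

theory Defs
  imports Complex_Main "Graph_Theory.Graph_Theory"
begin

text \<open>
  Finite simple undirected graphs are the \<^locale>\<open>pair_graph\<close>s of the library: finitely many
  vertices, no loops, and a symmetric set of arcs, so that an edge between \<open>u\<close> and \<open>v\<close> is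
  represented by the two arcs \<open>(u, v)\<close> and \<open>(v, u)\<close>. The locale admits the graph without vertices.
\<close>

definition proper_coloring :: "'a pair_pre_digraph \<Rightarrow> nat \<Rightarrow> ('a \<Rightarrow> nat) \<Rightarrow> bool" where
  "proper_coloring G k c \<longleftrightarrow>
     c ` pverts G \<subseteq> {..<k} \<and> (\<forall>(u, v) \<in> parcs G. c u \<noteq> c v)"

definition chromatic_number :: "'a pair_pre_digraph \<Rightarrow> nat" where
  "chromatic_number G = (LEAST k. \<exists>c. proper_coloring G k c)"

definition is_clique :: "'a pair_pre_digraph \<Rightarrow> 'a set \<Rightarrow> bool" where
  "is_clique G S \<longleftrightarrow>
     S \<subseteq> pverts G \<and> (\<forall>u \<in> S. \<forall>v \<in> S. u \<noteq> v \<longrightarrow> (u, v) \<in> parcs G)"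

definition clique_number :: "'a pair_pre_digraph \<Rightarrow> nat" where
  "clique_number G = Max (card ` {S. is_clique G S})"

text \<open>
  Every edge at \<open>v\<close> contributes exactly one arc with tail \<open>v\<close>, so the out-degree in the symmetric
  digraph is the degree in the undirected graph. The maximum is meaningful only if there is a vertex.
\<close>

definition max_degree :: "'a pair_pre_digraph \<Rightarrow> nat" where
  "max_degree G = Max (out_degree (with_proj G) ` pverts G)"

definition contains_induced :: "'a pair_pre_digraph \<Rightarrow> 'b pair_pre_digraph \<Rightarrow> bool" where
  "contains_induced G F \<longleftrightarrow>
     (\<exists>H. induced_subgraph H (with_proj G) \<and> digraph_iso H (with_proj F))"

definition graph_of_edges :: "'a set \<Rightarrow> ('a \<times> 'a) set \<Rightarrow> 'a pair_pre_digraph" where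
  "graph_of_edges V E = \<lparr>pverts = V, parcs = E \<union> E\<inverse>\<rparr>"

definition P5 :: "nat pair_pre_digraph" where
  "P5 = graph_of_edges {0..<5} {(0, 1), (1, 2), (2, 3), (3, 4)}"

text \<open>The cycle \<open>0, 1, 2, 3\<close> with the pendant vertex \<open>4\<close> attached to \<open>0\<close>.\<close>

definition banner :: "nat pair_pre_digraph" where
  "banner = graph_of_edges {0..<5} {(0, 1), (1, 2), (2, 3), (3, 0), (0, 4)}"

end

theory Submission
  imports Defs "HOL-Combinatorics.Cycles"
begin

text \<open>
  The proof is by induction on the number \<open>n\<close> of vertices (lemma \<open>reed_bound\<close>). If deleting some
  vertex does not lower \<open>\<chi>\<close>, the smaller graph settles the claim, since \<open>\<Delta>\<close> and \<open>\<omega>\<close> do not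
  increase. If the complement is disconnected, the graph is the join of two nonempty parts \<open>A\<close> and
  \<open>B\<close>. Induction gives \<open>2 \<chi>(A) \<le> \<Delta>(A) + \<omega>(A) + 2\<close>, every graph satisfies
  \<open>2 \<chi>(B) \<le> |B| + \<omega>(B)\<close>, and the sum of both is the claim, because in the join \<open>\<omega>\<close> is additive
  and every vertex of \<open>A\<close> gains \<open>|B|\<close> neighbours.

  What remains is a graph in which every vertex deletion lowers \<open>\<chi>\<close> and whose complement is
  connected. The heart of the matter is that such a graph has no stable set of three vertices (lemma
  \<open>no_stable3\<close>). Granting this, the non-neighbours of any vertex form a clique, so
  \<open>n \<le> \<Delta> + \<omega> + 1\<close>. Moreover the colour classes are single vertices and nonadjacent pairs: a best
  colouring is a maximum matching of the complement, criticality says that every vertex is missed by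
  some maximum matching, and Gallai's lemma (\<open>gallai_pairing\<close>) then says that a maximum matching
  misses at most one vertex. So \<open>2 \<chi> \<le> n + 1\<close>, and the two inequalities combine to the bound.

  Stable triples are excluded by producing clique cutsets, which a critical graph cannot have because
  colourings of the two sides could be permuted to agree on the clique. The order of events is this.
  An induced \<open>K\<^bsub>2,3\<^esub>\<close> would generate a module that is connected in the complement; a maximal such
  module yields a clique cutset. Without \<open>K\<^bsub>2,3\<^esub>\<close>, every induced \<open>C\<^sub>4\<close> and \<open>C\<^sub>5\<close> dominates the graph,
  because the vertices that it misses could be cut off by a clique. This leaves so little room for a
  stable triple that a \<open>C\<^sub>5\<close> becomes impossible next to it, and a \<open>C\<^sub>4\<close> is possible in one configuration
  only, which again has a clique cutset. With a stable triple there are thus neither \<open>C\<^sub>4\<close> nor \<open>C\<^sub>5\<close>,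
  and longer induced cycles contain a \<open>P\<^sub>5\<close>; so the graph is chordal, and a component of the
  non-neighbours of a vertex is cut off by a clique, as in Dirac's theorem.
\<close>

section \<open>Connected sets and components\<close>

text \<open>
  Connectivity is phrased through cuts, so that every use of it directly yields an edge across a cut.
  The relation is a parameter: the theory is applied to adjacency and to non-adjacency, that is, in
  the graph and in its complement.
\<close>

definition cut_connected :: "('a \<Rightarrow> 'a \<Rightarrow> bool) \<Rightarrow> 'a set \<Rightarrow> bool" where
  "cut_connected R Q \<longleftrightarrow>
     (\<forall>A\<subseteq>Q. A \<noteq> {} \<longrightarrow> A \<noteq> Q \<longrightarrow> (\<exists>x\<in>A. \<exists>y\<in>Q - A. R x y))"

definition component_in :: "('a \<Rightarrow> 'a \<Rightarrow> bool) \<Rightarrow> 'a set \<Rightarrow> 'a \<Rightarrow> 'a set" where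
  "component_in R X x = {y. (x, y) \<in> {(u, v). R u v \<and> v \<in> X}\<^sup>*}"

lemma cut_connectedD:
  assumes "cut_connected R Q" "x \<in> Q" "P x" "y \<in> Q" "\<not> P y"
  obtains p q where "p \<in> Q" "q \<in> Q" "P p" "\<not> P q" "R p q"
proof -
  let ?A = "{z \<in> Q. P z}"
  have "?A \<subseteq> Q" "?A \<noteq> {}" "?A \<noteq> Q" using assms by auto
  then obtain p q where "p \<in> ?A" "q \<in> Q - ?A" "R p q"
    using assms(1) unfolding cut_connected_def by meson
  then show thesis using that by blast
qed

lemma component_in_self: "x \<in> component_in R X x"
  by (simp add: component_in_def)

lemma component_in_subset: "x \<in> X \<Longrightarrow> component_in R X x \<subseteq> X"
proof
  fix y assume "x \<in> X" "y \<in> component_in R X x"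
  then show "y \<in> X" unfolding component_in_def by (auto elim: rtranclE)
qed

lemma component_in_closed:
  "y \<in> component_in R X x \<Longrightarrow> R y z \<Longrightarrow> z \<in> X \<Longrightarrow> z \<in> component_in R X x"
  unfolding component_in_def by (auto intro: rtrancl_into_rtrancl)

lemma component_in_least:
  assumes "x \<in> A" and closed: "\<And>y z. y \<in> A \<Longrightarrow> y \<in> component_in R X x \<Longrightarrow> z \<in> component_in R X x \<Longrightarrow> R y z \<Longrightarrow> z \<in> A"
  shows "component_in R X x \<subseteq> A"
proof
  fix y assume "y \<in> component_in R X x"
  then have "(x, y) \<in> {(u, v). R u v \<and> v \<in> X}\<^sup>*" by (simp add: component_in_def)
  then show "y \<in> A"
  proof (induction rule: rtrancl_induct)
    case base show ?case by fact
  next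
    case (step y z)
    have "y \<in> component_in R X x" "z \<in> component_in R X x"
      using step.hyps by (auto simp: component_in_def intro: rtrancl_into_rtrancl)
    with step show ?case using closed by blast
  qed
qed

lemma component_in_connected:
  assumes sym: "\<And>u v. R u v \<Longrightarrow> R v u"
  shows "cut_connected R (component_in R X x)"
  unfolding cut_connected_def
proof (intro allI impI)
  fix A let ?C = "component_in R X x"
  assume A: "A \<subseteq> ?C" "A \<noteq> {}" "A \<noteq> ?C"
  show "\<exists>x\<in>A. \<exists>y\<in>?C - A. R x y"
  proof (rule ccontr)
    assume none: "\<not> ?thesis"
    show False
    proof (cases "x \<in> A")
      case True
      have "?C \<subseteq> A" by (rule component_in_least[OF True]) (use none in blast)
      then show False using A by blast
    next
      case False
      have "?C \<subseteq> - A"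
      proof (rule component_in_least)
        show "x \<in> - A" using False by simp
        show "z \<in> - A" if "y \<in> - A" "y \<in> ?C" "z \<in> ?C" "R y z" for y z
          using none that sym[of y z] by blast
      qed
      then show False using A by blast
    qed
  qed
qed

lemma cut_connected_subset_component:
  assumes "cut_connected R L" "x \<in> L" "L \<subseteq> X"
  shows "L \<subseteq> component_in R X x"
proof (rule ccontr)
  assume "\<not> ?thesis"
  then obtain y where "y \<in> L" "y \<notin> component_in R X x" by blast
  then obtain p q where "q \<in> L" "p \<in> component_in R X x" "q \<notin> component_in R X x" "R p q"
    using cut_connectedD[OF assms(1,2), of "\<lambda>z. z \<in> component_in R X x" y] component_in_self by metis
  then show False using component_in_closed assms(3) by (metis subsetD)
qed

section \<open>Graphs without induced P5 and banner\<close>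

text \<open>
  Adjacency is relative to \<open>W\<close>: it implies membership, so that the edges of a forbidden subgraph already
  place its vertices in \<open>W\<close>. The pattern of adjacencies also forces the vertices to be distinct, except
  for \<open>b\<close> and \<open>d\<close> in \<open>no_banner\<close>, which are twins there.
\<close>

locale graph_on =
  fixes W :: "'a set" and adj :: "'a \<Rightarrow> 'a \<Rightarrow> bool" (infix "\<sim>" 50)
  assumes adj_sym: "x \<sim> y \<Longrightarrow> y \<sim> x"
    and adj_irrefl: "\<not> x \<sim> x"
    and adj_verts: "x \<sim> y \<Longrightarrow> x \<in> W"

locale P5_banner_free_graph = graph_on +
  assumes no_P5: "\<lbrakk>a \<sim> b; b \<sim> c; c \<sim> d; d \<sim> e;
      \<not> a \<sim> c; \<not> a \<sim> d; \<not> a \<sim> e; \<not> b \<sim> d; \<not> b \<sim> e; \<not> c \<sim> e\<rbrakk> \<Longrightarrow> False"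
    and no_banner: "\<lbrakk>a \<sim> b; b \<sim> c; c \<sim> d; d \<sim> a; a \<sim> e; b \<noteq> d;
      \<not> a \<sim> c; \<not> b \<sim> d; \<not> e \<sim> b; \<not> e \<sim> c; \<not> e \<sim> d\<rbrakk> \<Longrightarrow> False"
begin

lemma adj_verts2: "x \<sim> y \<Longrightarrow> y \<in> W"
  using adj_sym adj_verts by blast

lemma adj_commute: "x \<sim> y \<longleftrightarrow> y \<sim> x"
  using adj_sym by blast

abbreviation nonadj :: "'a \<Rightarrow> 'a \<Rightarrow> bool" where
  "nonadj x y \<equiv> \<not> x \<sim> y"

definition C4 :: "'a \<Rightarrow> 'a \<Rightarrow> 'a \<Rightarrow> 'a \<Rightarrow> bool" where
  "C4 a b c d \<longleftrightarrow> a \<sim> b \<and> b \<sim> c \<and> c \<sim> d \<and> d \<sim> a \<and> a \<noteq> c \<and> b \<noteq> d \<and> nonadj a c \<and> nonadj b d"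

definition C5 :: "'a \<Rightarrow> 'a \<Rightarrow> 'a \<Rightarrow> 'a \<Rightarrow> 'a \<Rightarrow> bool" where
  "C5 a b c d e \<longleftrightarrow> a \<sim> b \<and> b \<sim> c \<and> c \<sim> d \<and> d \<sim> e \<and> e \<sim> a \<and>
     nonadj a c \<and> nonadj a d \<and> nonadj b d \<and> nonadj b e \<and> nonadj c e"

definition stable3 :: "'a \<Rightarrow> 'a \<Rightarrow> 'a \<Rightarrow> bool" where
  "stable3 x y z \<longleftrightarrow> {x, y, z} \<subseteq> W \<and> x \<noteq> y \<and> x \<noteq> z \<and> y \<noteq> z \<and>
     nonadj x y \<and> nonadj x z \<and> nonadj y z"

lemma C4_rotate: "C4 a b c d \<Longrightarrow> C4 b c d a"
  unfolding C4_def using adj_sym by blast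

lemma C4_reflect: "C4 a b c d \<Longrightarrow> C4 a d c b"
  unfolding C4_def using adj_sym by blast

lemma C5_rotate: "C5 a b c d e \<Longrightarrow> C5 b c d e a"
  unfolding C5_def using adj_sym by blast

lemma C5_reflect: "C5 a b c d e \<Longrightarrow> C5 a e d c b"
  unfolding C5_def using adj_sym by blast

lemma stable3_perm: "stable3 x y z \<Longrightarrow> stable3 y x z" "stable3 x y z \<Longrightarrow> stable3 x z y"
  unfolding stable3_def using adj_sym by auto

text \<open>
  Two nonadjacent neighbours of \<open>s\<close> that both see a connected set far from \<open>s\<close> close up to an induced
  cycle through that set. If they have no common neighbour in the set, take an edge \<open>p p'\<close> at which the
  neighbourhood of \<open>f\<close> ends: either \<open>p'\<close> sees \<open>f'\<close> and the cycle has length five, or \<open>f', s, f, p, p'\<close>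
  is an induced path.
\<close>

lemma hole_through_connected_set:
  assumes "cut_connected adj Q" and "s \<notin> Q" and s: "s \<sim> f" "s \<sim> f'" and far: "\<And>q. q \<in> Q \<Longrightarrow> nonadj s q"
    and ff: "nonadj f f'" "f \<noteq> f'" and q: "q \<in> Q" "f \<sim> q" and q': "q' \<in> Q" "f' \<sim> q'"
  shows "(\<exists>p\<in>Q. C4 s f p f') \<or> (\<exists>p\<in>Q. \<exists>p'\<in>Q. C5 s f p p' f')"
proof (cases "\<exists>p\<in>Q. f \<sim> p \<and> f' \<sim> p")
  case True
  then obtain p where p: "p \<in> Q" "f \<sim> p" "f' \<sim> p" by blast
  have "s \<noteq> p" using p \<open>s \<notin> Q\<close> by blast
  then have "C4 s f p f'" unfolding C4_def using p s ff far[OF p(1)] adj_sym by blast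
  then show ?thesis using p by blast
next
  case False
  then have "\<not> f \<sim> q'" using q' by blast
  with assms obtain p p' where p: "p \<in> Q" "p' \<in> Q" "f \<sim> p" "\<not> f \<sim> p'" "p \<sim> p'"
    by (metis cut_connectedD[of adj Q q "\<lambda>z. f \<sim> z" q'])
  have "nonadj f' p" using False p by blast
  show ?thesis
  proof (cases "f' \<sim> p'")
    case True
    then have "C5 s f p p' f'" unfolding C5_def
      using p s ff far[OF p(1)] far[OF p(2)] \<open>nonadj f' p\<close> adj_sym by blast
    then show ?thesis using p by blast
  next
    case False
    then show ?thesis
      using no_P5[of f' s f p p'] p s ff far[OF p(1)] far[OF p(2)] \<open>nonadj f' p\<close> adj_sym by blast
  qed
qed

end

section \<open>Modules and \<open>K\<^bsub>2,3\<^esub>\<close>\<close>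

text \<open>
  The two consequences of criticality and of a connected complement that the structural part uses: the
  complement is connected, and the neighbourhood of a set \<open>Q\<close> that leaves some vertex outside its
  closed neighbourhood is never a clique. For empty neighbourhoods the latter says that the graph
  is connected.
\<close>

locale indecomposable_P5_banner_free_graph = P5_banner_free_graph +
  assumes finite_W: "finite W"
    and co_connected: "cut_connected nonadj W"
    and no_clique_cutset: "\<lbrakk>Q \<subseteq> W; Q \<noteq> {}; r \<in> W; r \<notin> Q; \<And>q. q \<in> Q \<Longrightarrow> nonadj r q\<rbrakk> \<Longrightarrow>
      \<exists>f f' q q'. f \<notin> Q \<and> f' \<notin> Q \<and> f \<noteq> f' \<and> nonadj f f' \<and>
        q \<in> Q \<and> f \<sim> q \<and> q' \<in> Q \<and> f' \<sim> q'"
begin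

text \<open>
  Anticonnected means connected in the complement. Such a module contains a nonadjacent pair, and every
  vertex outside sees all or nothing of it. The last conjunct makes the notion self-dual: it passes
  from a module to a module inside its common neighbourhood.
\<close>

definition anticonnected_module :: "'a set \<Rightarrow> bool" where
  "anticonnected_module L \<longleftrightarrow> L \<subseteq> W \<and> cut_connected nonadj L \<and>
     (\<exists>a\<in>L. \<exists>b\<in>L. a \<noteq> b \<and> nonadj a b) \<and>
     (\<forall>v\<in>W - L. \<forall>x\<in>L. \<forall>y\<in>L. v \<sim> x \<longrightarrow> v \<sim> y) \<and>
     (\<exists>v\<in>W. \<forall>x\<in>L. v \<sim> x)"

definition common_neighbours :: "'a set \<Rightarrow> 'a set" where
  "common_neighbours L = {v \<in> W. \<forall>x\<in>L. v \<sim> x}"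

text \<open>
  The components of the complement, taken inside the common neighbourhood of a module, are modules
  again. Otherwise some vertex \<open>v\<close>, which sees nothing of the module, splits a nonadjacent pair of common
  neighbours. That pair forms a four-cycle with a nonadjacent pair of the module, and \<open>v\<close> makes it
  a banner.
\<close>

lemma anticonnected_module_dual:
  assumes L: "anticonnected_module L"
    and p: "p \<in> common_neighbours L" "p' \<in> common_neighbours L" "p \<noteq> p'" "nonadj p p'"
  shows "anticonnected_module (component_in nonadj (common_neighbours L) p)"
proof -
  let ?N = "common_neighbours L"
  let ?M = "component_in nonadj ?N p"
  obtain a b where ab: "a \<in> L" "b \<in> L" "a \<noteq> b" "nonadj a b"
    using L unfolding anticonnected_module_def by blast
  have MN: "?M \<subseteq> ?N" using p by (intro component_in_subset)
  have conn: "cut_connected nonadj ?M"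
    by (rule component_in_connected) (use adj_sym in blast)
  have pM: "p \<in> ?M" by (rule component_in_self)
  have p'M: "p' \<in> ?M" using component_in_closed[OF pM, of p'] p by blast
  have mod: "v \<sim> y" if v: "v \<in> W - ?M" and x: "x \<in> ?M" "v \<sim> x" and y: "y \<in> ?M" for v x y
  proof (rule ccontr)
    assume "\<not> v \<sim> y"
    then obtain p1 q1 where pq: "p1 \<in> ?M" "q1 \<in> ?M" "v \<sim> p1" "\<not> v \<sim> q1" "nonadj p1 q1"
      using cut_connectedD[OF conn x(1), of "\<lambda>z. v \<sim> z" y] x y by metis
    have "v \<notin> ?N"
      using component_in_closed[OF pq(2), of v] pq adj_sym v by blast
    have "v \<notin> L" using pq(2,4) MN unfolding common_neighbours_def using adj_sym by blast
    then have far: "nonadj v a" "nonadj v b"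
      using \<open>v \<notin> ?N\<close> L v ab unfolding anticonnected_module_def common_neighbours_def by blast+
    have "p1 \<sim> a" "p1 \<sim> b" "q1 \<sim> a" "q1 \<sim> b"
      using pq MN ab unfolding common_neighbours_def by blast+
    then show False
      using no_banner[of p1 a q1 b v] pq ab far by (auto simp: adj_commute)
  qed
  have "a \<in> W" "\<forall>x\<in>?M. a \<sim> x"
    using ab MN L adj_sym unfolding anticonnected_module_def common_neighbours_def by blast+
  moreover have "?M \<subseteq> W" using MN unfolding common_neighbours_def by blast
  ultimately show ?thesis
    unfolding anticonnected_module_def using conn pM p'M p mod by blast
qed

text \<open>
  Let \<open>L\<close> be maximal, \<open>N\<close> its common neighbours and \<open>R\<close> the rest, which is nonempty because the
  complement is connected. The neighbourhood of \<open>R\<close> lies in \<open>N\<close> and is not a clique, so some vertex of \<open>R\<close>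
  sees a member of a module \<open>M\<close> inside \<open>N\<close>, hence all of it. Going back from \<open>M\<close> to the module around
  \<open>L\<close> in the common neighbourhood of \<open>M\<close> then picks up this vertex as well, against maximality.
\<close>

lemma no_anticonnected_module: "\<not> anticonnected_module L"
proof
  assume "anticonnected_module L"
  moreover have "finite {L. anticonnected_module L}"
    by (rule finite_subset[of _ "Pow W"]) (auto simp: finite_W anticonnected_module_def)
  ultimately obtain L where L: "anticonnected_module L"
    and max: "\<And>K. anticonnected_module K \<Longrightarrow> L \<subseteq> K \<Longrightarrow> L = K"
    using finite_has_maximal[of "{L. anticonnected_module L}"] by blast
  let ?N = "common_neighbours L"
  define R where "R = W - L - ?N"
  obtain a where a: "a \<in> L" "a \<in> W" using L unfolding anticonnected_module_def by blast
  obtain v where v: "v \<in> W" "v \<notin> L"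
    using L adj_irrefl unfolding anticonnected_module_def by blast
  have LR: "nonadj l r" if "l \<in> L" "r \<in> R" for l r
    using that L adj_sym unfolding anticonnected_module_def R_def common_neighbours_def by blast
  obtain x y where xy: "x \<in> L" "y \<in> W" "y \<notin> L" "nonadj x y"
    using cut_connectedD[OF co_connected, of a "\<lambda>z. z \<in> L" v] a v by metis
  then have "y \<in> R" unfolding R_def common_neighbours_def using adj_sym by blast
  then have "R \<subseteq> W" "R \<noteq> {}" "a \<notin> R" using a by (auto simp: R_def)
  then obtain f f' q q' where f: "f \<notin> R" "f' \<notin> R" "f \<noteq> f'" "nonadj f f'"
      "q \<in> R" "f \<sim> q" "q' \<in> R" "f' \<sim> q'"
    using no_clique_cutset[of R a] LR a by blast
  have fN: "f \<in> ?N" "f' \<in> ?N" using f LR adj_verts unfolding R_def by blast+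
  let ?M = "component_in nonadj ?N f"
  have M: "anticonnected_module ?M" using anticonnected_module_dual[OF L fN f(3,4)] .
  have MN: "?M \<subseteq> ?N" using fN by (intro component_in_subset)
  let ?L = "component_in nonadj (common_neighbours ?M) a"
  have sub: "L \<subseteq> common_neighbours ?M"
    using MN L adj_sym unfolding common_neighbours_def anticonnected_module_def by blast
  have conn: "cut_connected nonadj L" using L unfolding anticonnected_module_def by blast
  obtain b c where bc: "b \<in> L" "c \<in> L" "b \<noteq> c" "nonadj b c"
    using L unfolding anticonnected_module_def by blast
  obtain b where b: "b \<in> L" "a \<noteq> b" "nonadj a b"
    using cut_connectedD[OF conn a(1), of "\<lambda>z. z = a"] bc by metis
  have L': "anticonnected_module ?L"
    using anticonnected_module_dual[OF M, of a b] sub a b by blast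
  have "L \<subseteq> ?L" using cut_connected_subset_component[OF conn a(1) sub] .
  moreover have "q \<in> ?L"
  proof (rule component_in_closed[OF component_in_self])
    show "nonadj a q" using LR a f by blast
    have "q \<in> W - ?M" using f(5) MN unfolding R_def by blast
    then show "q \<in> common_neighbours ?M"
      using M f(6) adj_sym component_in_self[of f] unfolding common_neighbours_def anticonnected_module_def by blast
  qed
  ultimately show False using max[OF L'] f(5) unfolding R_def by blast
qed

text \<open>
  A vertex that splits a nonadjacent pair of common neighbours of a stable triple must itself be
  complete to the triple, again by banners. So the complement component of that pair inside the common
  neighbourhood of the triple would be a module.
\<close>

lemma no_K23:
  assumes S: "stable3 s t u" and ab: "a \<noteq> b" "nonadj a b"
    and a: "a \<sim> s" "a \<sim> t" "a \<sim> u" and b: "b \<sim> s" "b \<sim> t" "b \<sim> u"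
  shows False
proof -
  define C where "C = {v. v \<sim> s \<and> v \<sim> t \<and> v \<sim> u}"
  let ?L = "component_in nonadj C a"
  have aC: "a \<in> C" "b \<in> C" using a b C_def by auto
  have LC: "?L \<subseteq> C" using aC by (intro component_in_subset)
  have conn: "cut_connected nonadj ?L"
    by (rule component_in_connected) (use adj_sym in blast)
  have aL: "a \<in> ?L" by (rule component_in_self)
  have bL: "b \<in> ?L" using component_in_closed[OF aL, of b] ab aC by blast
  have mod: "v \<sim> y" if v: "v \<in> W - ?L" and x: "x \<in> ?L" "v \<sim> x" and y: "y \<in> ?L" for v x y
  proof (rule ccontr)
    assume "\<not> v \<sim> y"
    then obtain p q where pq: "p \<in> ?L" "q \<in> ?L" "v \<sim> p" "\<not> v \<sim> q" "nonadj p q"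
      using cut_connectedD[OF conn x(1), of "\<lambda>z. v \<sim> z" y] x y by metis
    have "v \<notin> C" using component_in_closed[OF pq(2), of v] pq adj_sym v by blast
    have pqS: "p \<sim> s" "p \<sim> t" "p \<sim> u" "q \<sim> s" "q \<sim> t" "q \<sim> u"
      using pq LC unfolding C_def by blast+
    have *: "v \<sim> x \<or> v \<sim> y"
      if "p \<sim> x" "p \<sim> y" "q \<sim> x" "q \<sim> y" "x \<noteq> y" "nonadj x y" for x y
      using no_banner[of p x q y v] pq that by (auto simp: adj_commute)
    have **: False
      if "p \<sim> x" "p \<sim> y" "q \<sim> x" "q \<sim> y" "x \<noteq> y" "nonadj x y" "v \<sim> x" "v \<sim> y"
        "q \<sim> z" "nonadj z x" "nonadj z y" "nonadj v z" for x y z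
      using no_banner[of q x v y z] pq that by (auto simp: adj_commute)
    note st = S[unfolded stable3_def] adj_commute[of t s] adj_commute[of u s] adj_commute[of u t]
    have "v \<sim> s \<or> v \<sim> t" "v \<sim> s \<or> v \<sim> u" "v \<sim> t \<or> v \<sim> u"
      using *[of s t] *[of s u] *[of t u] pqS st by simp_all
    moreover have "\<not> (v \<sim> s \<and> v \<sim> t \<and> v \<sim> u)" using \<open>v \<notin> C\<close> C_def by simp
    ultimately consider "v \<sim> s" "v \<sim> t" "\<not> v \<sim> u" | "v \<sim> s" "v \<sim> u" "\<not> v \<sim> t"
      | "v \<sim> t" "v \<sim> u" "\<not> v \<sim> s" by argo
    then show False
      using **[of s t u] **[of s u t] **[of t u s] pqS st by cases simp_all
  qed
  have "s \<in> W" "\<forall>x\<in>?L. s \<sim> x" using S LC adj_sym unfolding stable3_def C_def by blast+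
  moreover have "?L \<subseteq> W" using LC adj_verts unfolding C_def by blast
  ultimately have "anticonnected_module ?L"
    unfolding anticonnected_module_def using conn aL bL ab mod by blast
  then show False using no_anticonnected_module by blast
qed

section \<open>Short holes dominate\<close>

text \<open>
  Let \<open>Z\<close> be the set of vertices that the cycle misses. A vertex that sees both \<open>Z\<close> and the cycle is
  complete to the cycle, and two nonadjacent such vertices form a four-cycle with \<open>x\<close> and \<open>y\<close> that
  together with a vertex of \<open>Z\<close> is a banner or a \<open>K\<^bsub>2,3\<^esub>\<close>. So \<open>Z\<close> would be cut off by a clique.
\<close>

lemma C4_dominating:
  assumes C: "C4 x a y b" and "v \<in> W"
  shows "v \<sim> x \<or> v \<sim> a \<or> v \<sim> y \<or> v \<sim> b"
proof (rule ccontr)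
  define Z where "Z = {v \<in> W. nonadj v x \<and> nonadj v a \<and> nonadj v y \<and> nonadj v b}"
  note c = C[unfolded C4_def]
  assume "\<not> ?thesis"
  then have "v \<in> Z" using assms by (simp add: Z_def)
  then have "Z \<subseteq> W" "Z \<noteq> {}" by (auto simp: Z_def)
  moreover have "x \<in> W" "x \<notin> Z" using c adj_verts by (auto simp: Z_def)
  ultimately obtain f f' q q' where f: "f \<notin> Z" "f' \<notin> Z" "f \<noteq> f'" "nonadj f f'"
      "q \<in> Z" "f \<sim> q" "q' \<in> Z" "f' \<sim> q'"
    using no_clique_cutset[of Z x] adj_sym unfolding Z_def by blast
  have complete: "w \<sim> x \<and> w \<sim> a \<and> w \<sim> y \<and> w \<sim> b" if "w \<notin> Z" "w \<sim> z" "z \<in> Z" for w z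
  proof -
    have z: "z \<in> W" "nonadj z x" "nonadj z a" "nonadj z y" "nonadj z b"
      using that(3) by (auto simp: Z_def)
    \<comment> \<open>From one neighbour on the cycle to the next; rotation then gives all four.\<close>
    have step: "w \<sim> q" if p: "C4 p q r s" "w \<sim> p"
      "nonadj z p" "nonadj z q" "nonadj z r" "nonadj z s" for p q r s
    proof (rule ccontr)
      assume "nonadj w q"
      note c = p(1)[unfolded C4_def]
      have "w \<in> W" "q \<in> W" "s \<in> W" using that adj_verts c by blast+
      have "w \<noteq> q" using that z \<open>w \<sim> z\<close> adj_sym by blast
      have "w \<noteq> s" using that z \<open>w \<sim> z\<close> adj_sym by blast
      show False
      proof (cases "w \<sim> s"; cases "w \<sim> r")
        assume "w \<sim> s" "w \<sim> r"
        then show False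
          using no_banner[of w p q r z] p c \<open>nonadj w q\<close> \<open>w \<sim> z\<close> by (auto simp: adj_commute)
      next
        assume "w \<sim> s" "nonadj w r"
        then show False
          using no_P5[of z w s r q] p c \<open>nonadj w q\<close> \<open>w \<sim> z\<close> by (auto simp: adj_commute)
      next
        assume "nonadj w s" "w \<sim> r"
        then show False
          using no_K23[of w q s p r] p c \<open>nonadj w q\<close> \<open>w \<noteq> q\<close> \<open>w \<noteq> s\<close> \<open>w \<in> W\<close> \<open>q \<in> W\<close> \<open>s \<in> W\<close> 
          by (auto simp: adj_commute stable3_def)
      next
        assume "nonadj w s" "nonadj w r"
        then show False
          using no_banner[of p q r s w] p c \<open>nonadj w q\<close> by (auto simp: adj_commute)
      qed
    qed
    have "w \<sim> x \<or> w \<sim> a \<or> w \<sim> y \<or> w \<sim> b"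
      using that adj_verts[of w z] unfolding Z_def by blast
    then show ?thesis
      using step[OF C] step[OF C4_rotate[OF C]] step[OF C4_rotate[OF C4_rotate[OF C]]]
        step[OF C4_rotate[OF C4_rotate[OF C4_rotate[OF C]]]] z by blast
  qed
  have fc: "f \<sim> x" "f \<sim> y" "f' \<sim> x" "f' \<sim> y"
    using complete f by blast+
  have q: "q \<in> W" "nonadj q x" "nonadj q y" using f(5) by (auto simp: Z_def)
  show False
  proof (cases "f' \<sim> q")
    case True
    have "stable3 q x y"
      using q c adj_verts adj_sym f(5) unfolding stable3_def Z_def by blast
    then show False using no_K23[of q x y f f'] True f fc by blast
  next
    case False
    then show False using no_banner[of f x f' y q] q f fc c by (auto simp: adj_commute)
  qed
qed

text \<open>
  In other words, no stable triple contains two opposite vertices of a four-cycle. This is the form in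
  which domination is used from here on.
\<close>

lemma C4_opposite:
  assumes C: "C4 x a y b" and v: "v \<in> W" "v \<noteq> x" "v \<noteq> y"
  shows "v \<sim> x \<or> v \<sim> y"
proof (rule ccontr)
  assume n: "\<not> ?thesis"
  note c = C[unfolded C4_def]
  have "v \<sim> a \<or> v \<sim> b" using C4_dominating[OF C v(1)] n by blast
  then consider "v \<sim> a" "v \<sim> b" | "v \<sim> a" "nonadj v b" | "nonadj v a" "v \<sim> b" by blast
  then show False
  proof cases
    case 1
    have "stable3 v x y" using v n c adj_verts unfolding stable3_def by blast
    then show False using no_K23[of v x y a b] 1 c adj_sym by blast
  next
    case 2
    then show False using no_banner[of a x b y v] n c by (auto simp: adj_commute)
  next
    case 3
    then show False using no_banner[of b x a y v] n c by (auto simp: adj_commute)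
  qed
qed

text \<open>
  As for four-cycles, but two nonadjacent attachments now form a four-cycle with the nonadjacent
  vertices \<open>a\<close> and \<open>c\<close>, which a missed vertex contradicts at once.
\<close>

lemma C5_dominating:
  assumes C: "C5 a b c d e" and "v \<in> W"
  shows "v \<sim> a \<or> v \<sim> b \<or> v \<sim> c \<or> v \<sim> d \<or> v \<sim> e"
proof (rule ccontr)
  define Z where "Z = {v \<in> W. nonadj v a \<and> nonadj v b \<and> nonadj v c \<and> nonadj v d \<and> nonadj v e}"
  assume "\<not> ?thesis"
  then have "v \<in> Z" using assms by (simp add: Z_def)
  then have "Z \<subseteq> W" "Z \<noteq> {}" by (auto simp: Z_def)
  moreover have "a \<in> W" "a \<notin> Z" using C adj_verts by (auto simp: Z_def C5_def)
  ultimately obtain f f' q q' where f: "f \<notin> Z" "f' \<notin> Z" "f \<noteq> f'" "nonadj f f'"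
      "q \<in> Z" "f \<sim> q" "q' \<in> Z" "f' \<sim> q'"
    using no_clique_cutset[of Z a] adj_sym unfolding Z_def by blast
  have complete: "w \<sim> a \<and> w \<sim> c" if "w \<notin> Z" "w \<sim> z" "z \<in> Z" for w z
  proof -
    have z: "nonadj z a" "nonadj z b" "nonadj z c" "nonadj z d" "nonadj z e"
      using that(3) by (auto simp: Z_def)
    have step: "w \<sim> q" if p: "C5 p q r s t" "w \<sim> p"
      "nonadj z p" "nonadj z q" "nonadj z r" "nonadj z s" "nonadj z t" for p q r s t
    proof (rule ccontr)
      assume n: "nonadj w q"
      note c = p(1)[unfolded C5_def]
      have d: "w \<noteq> p" "w \<noteq> q" "w \<noteq> r" "w \<noteq> s" "w \<noteq> t" using that \<open>w \<sim> z\<close> adj_sym by blast+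
      have r: "\<not> w \<sim> r"
        using no_banner[of w p q r z] p c n d \<open>w \<sim> z\<close> by (auto simp: adj_commute)
      have s: "\<not> w \<sim> s"
        using no_P5[of z w s r q] p c n r d \<open>w \<sim> z\<close> by (auto simp: adj_commute)
      show False
        using no_P5[of z w p q r] p c n d r \<open>w \<sim> z\<close> by (auto simp: adj_commute)
    qed
    have "w \<sim> a \<or> w \<sim> b \<or> w \<sim> c \<or> w \<sim> d \<or> w \<sim> e"
      using that adj_verts[of w z] unfolding Z_def by blast
    then show ?thesis
      using step[OF C] step[OF C5_rotate[OF C]] step[OF C5_rotate[OF C5_rotate[OF C]]]
        step[OF C5_rotate[OF C5_rotate[OF C5_rotate[OF C]]]]
        step[OF C5_rotate[OF C5_rotate[OF C5_rotate[OF C5_rotate[OF C]]]]] z by blast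
  qed
  have "f \<sim> a" "f \<sim> c" "f' \<sim> a" "f' \<sim> c" using complete f by blast+
  then have "C4 a f c f'" using f C adj_sym unfolding C4_def C5_def by blast
  then have "q \<sim> a \<or> q \<sim> c" using C4_opposite[of a f c f' q] f C unfolding Z_def C5_def by blast
  then show False using f(5) by (auto simp: Z_def)
qed

lemma C5_opposite:
  assumes C: "C5 a b c d e" and v: "v \<in> W" "v \<noteq> a" "v \<noteq> c"
  shows "v \<sim> a \<or> v \<sim> c"
proof (rule ccontr)
  assume "\<not> ?thesis"
  then have n: "nonadj v a" "nonadj v c" by blast+
  note c = C[unfolded C5_def]
  have d: "v \<noteq> b" "v \<noteq> d" "v \<noteq> e" using n c adj_sym by blast+
  have b: "nonadj v b"
  proof
    assume vb: "v \<sim> b"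
    have vd: "nonadj v d"
    proof
      assume vd: "v \<sim> d"
      show False
      proof (cases "v \<sim> e")
        case True
        then show False using no_banner[of b v d c a] vb vd n c v by (auto simp: adj_commute)
      next
        case False
        then show False using no_banner[of d c b v e] vb vd n c v by (auto simp: adj_commute)
      qed
    qed
    show False
    proof (cases "v \<sim> e")
      case True
      then show False using no_banner[of e a b v d] vb vd n c v by (auto simp: adj_commute)
    next
      case False
      then show False using no_P5[of v b c d e] vb vd n c by (auto simp: adj_commute)
    qed
  qed
  have "v \<sim> d \<or> v \<sim> e" using C5_dominating[OF C v(1)] n b by blast
  then consider "v \<sim> d" "v \<sim> e" | "v \<sim> d" "nonadj v e" | "nonadj v d" "v \<sim> e" by blast
  then show False
  proof cases
    case 1
    then show False using no_P5[of v d c b a] n b c by (auto simp: adj_commute)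
  next
    case 2
    then show False using no_P5[of v d e a b] n b c by (auto simp: adj_commute)
  next
    case 3
    then show False using no_P5[of v e d c b] n b c by (auto simp: adj_commute)
  qed
qed

section \<open>Stable triples exclude four- and five-cycles\<close>

text \<open>
  By \<open>C5_opposite\<close> the other two members of the triple lie off the cycle, see \<open>c\<close> and \<open>d\<close>, and each
  sees \<open>b\<close> or \<open>e\<close>. If they share \<open>b\<close> or \<open>e\<close> there is a banner, and otherwise a \<open>P\<^sub>5\<close> through \<open>a\<close>.
\<close>

lemma stable3_off_C5:
  assumes C: "C5 a b c d e" and S: "stable3 a s t"
  shows False
proof -
  note k = C[unfolded C5_def]
  note st = S[unfolded stable3_def]
  have W: "s \<in> W" "t \<in> W" using st by auto
  have off: "s' \<noteq> c \<and> s' \<noteq> d" if "stable3 a s' t'" for s' t'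
    using C5_opposite[OF C, of t'] C5_opposite[OF C5_reflect[OF C], of t'] that
    unfolding stable3_def by (auto simp: adj_commute)
  have off_s: "s \<noteq> c" "s \<noteq> d" "t \<noteq> c" "t \<noteq> d" using off[OF S] off[of t s] S stable3_perm by blast+
  have adj: "s' \<sim> c \<and> s' \<sim> d \<and> (s' \<sim> b \<or> s' \<sim> e)"
    if "s' \<in> W" "nonadj a s'" "s' \<noteq> a" "s' \<noteq> c" "s' \<noteq> d" for s'
  proof -
    have "C5 e a b c d" using C5_rotate C by blast
    moreover have "s' \<noteq> b" "s' \<noteq> e" using that k by (auto simp: adj_commute)
    ultimately show ?thesis
      using C5_opposite[OF C, of s'] C5_opposite[OF C5_reflect[OF C], of s']
        C5_opposite[of e a b c d s'] that
      by (auto simp: adj_commute)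
  qed
  have s: "s \<sim> c" "s \<sim> d" "s \<sim> b \<or> s \<sim> e" and t: "t \<sim> c" "t \<sim> d" "t \<sim> b \<or> t \<sim> e"
    using adj[of s] adj[of t] W off_s st by auto
  consider "s \<sim> b" "t \<sim> b" | "s \<sim> e" "t \<sim> e" | "s \<sim> b" "t \<sim> e" "nonadj s e" "nonadj t b"
    | "s \<sim> e" "t \<sim> b" "nonadj s b" "nonadj t e" using s t by blast
  then show False
  proof cases
    case 1
    then show False using no_banner[of b s d t a] s t st k by (auto simp: adj_commute)
  next
    case 2
    then show False using no_banner[of e s c t a] s t st k by (auto simp: adj_commute)
  next
    case 3
    then show False using no_P5[of s b a e t] s t st k by (auto simp: adj_commute)
  next
    case 4
    then show False using no_P5[of t b a e s] s t st k by (auto simp: adj_commute)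
  qed
qed

lemma stable3_or_two_neighbours:
  assumes "stable3 s t u" "z \<in> W"
  shows "(\<exists>p q. stable3 z p q) \<or> z \<sim> s \<and> z \<sim> t \<or> z \<sim> s \<and> z \<sim> u \<or> z \<sim> t \<and> z \<sim> u"
proof (cases "z = s \<or> z = t \<or> z = u")
  case True
  then show ?thesis using assms stable3_perm by blast
next
  case False
  then have "\<not> z \<sim> s \<Longrightarrow> \<not> z \<sim> t \<Longrightarrow> stable3 z s t" "\<not> z \<sim> s \<Longrightarrow> \<not> z \<sim> u \<Longrightarrow> stable3 z s u"
    "\<not> z \<sim> t \<Longrightarrow> \<not> z \<sim> u \<Longrightarrow> stable3 z t u"
    using assms unfolding stable3_def by auto
  then show ?thesis by blast
qed

text \<open>
  If the two vertices share two members of the triple, these members are opposite on a four-cycle, which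
  the third member contradicts. If they share one member only, a \<open>P\<^sub>5\<close> runs through it.
\<close>

lemma two_neighbours_adjacent:
  assumes S: "stable3 s t u" and vw: "v \<noteq> w" "nonadj v w"
    and v: "v \<sim> s \<and> v \<sim> t \<or> v \<sim> s \<and> v \<sim> u \<or> v \<sim> t \<and> v \<sim> u"
    and w: "w \<sim> s \<and> w \<sim> t \<or> w \<sim> s \<and> w \<sim> u \<or> w \<sim> t \<and> w \<sim> u"
  shows False
proof -
  have same: False if "stable3 p q r" "v \<sim> p" "v \<sim> q" "w \<sim> p" "w \<sim> q" for p q r
  proof -
    have "C4 p v q w" using that vw unfolding C4_def stable3_def by (auto simp: adj_commute)
    then show False using C4_opposite[of p v q w r] that(1)
      unfolding stable3_def by (auto simp: adj_commute)
  qed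
  have different: False if "stable3 p q r" "v \<sim> p" "v \<sim> q" "w \<sim> q" "w \<sim> r" for p q r
  proof -
    have "nonadj v r" "nonadj w p"
      using same[of q r p] same[of p q r] that stable3_perm by blast+
    then show False
      using no_P5[of p v q w r] that vw unfolding stable3_def by (auto simp: adj_commute)
  qed
  have perms: "stable3 s t u" "stable3 s u t" "stable3 t s u" "stable3 t u s" "stable3 u s t" "stable3 u t s"
    using S stable3_perm by blast+
  show False
    using v w same[OF perms(1)] same[OF perms(2)] same[OF perms(4)] different[OF perms(1)]
      different[OF perms(2)] different[OF perms(3)] different[OF perms(4)] different[OF perms(5)]
      different[OF perms(6)] by argo
qed

text \<open>
  The nonadjacent vertices \<open>a\<close> and \<open>c\<close> cannot both see two members of the triple, so one of them
  lies in a stable triple, and this triple meets the cycle.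
\<close>

lemma no_C5_if_stable3:
  assumes C: "C5 a b c d e" and S: "stable3 s t u"
  shows False
proof -
  have W: "a \<in> W" "c \<in> W" and ac: "a \<noteq> c" "nonadj a c"
    using C adj_verts adj_sym unfolding C5_def by blast+
  have "C5 c d e a b" using C C5_rotate by blast
  then show False
    using stable3_or_two_neighbours[OF S W(1)] stable3_or_two_neighbours[OF S W(2)]
      stable3_off_C5[OF C] stable3_off_C5[of c d e a b] two_neighbours_adjacent[OF S ac] by blast
qed

text \<open>
  The only way in which a stable triple can meet a four-cycle: its two members off the cycle see the same
  neighbour of \<open>x\<close> on the cycle and miss the other one.
\<close>

lemma stable3_meeting_C4:
  assumes C: "C4 x a y b" and S: "stable3 x s t"
  shows "s \<sim> a \<and> t \<sim> a \<and> nonadj s b \<and> nonadj t b \<or> s \<sim> b \<and> t \<sim> b \<and> nonadj s a \<and> nonadj t a"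
proof -
  note k = C[unfolded C4_def]
  note st = S[unfolded stable3_def]
  have W: "s \<in> W" "t \<in> W" using st by auto
  have d: "s \<noteq> a" "s \<noteq> b" "t \<noteq> a" "t \<noteq> b" using k st adj_sym by blast+
  have s: "s \<sim> a \<or> s \<sim> b" and t: "t \<sim> a \<or> t \<sim> b"
    using C4_opposite[OF C4_rotate[OF C], of s] C4_opposite[OF C4_rotate[OF C], of t] W d by blast+
  have one: "t' \<sim> a' \<and> nonadj t' b'"
    if C': "C4 x a' y b'" and S': "stable3 x s' t'" and s': "s' \<sim> a'" "nonadj s' b'"
      and t': "t' \<sim> a' \<or> t' \<sim> b'" for a' b' s' t'
  proof (rule ccontr)
    assume "\<not> ?thesis"
    then have tb: "t' \<sim> b'" using t' by blast
    show False
    proof (cases "t' \<sim> a'")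
      case True
      then show False using no_banner[of a' x b' t' s'] C' S' s' tb
        unfolding C4_def stable3_def by (auto simp: adj_commute)
    next
      case False
      then show False using no_P5[of s' a' x b' t'] C' S' s' tb
        unfolding C4_def stable3_def by (auto simp: adj_commute)
    qed
  qed
  have "\<not> (s \<sim> a \<and> s \<sim> b \<and> t \<sim> a \<and> t \<sim> b)"
    using no_K23[OF S, of a b] k by (auto simp: adj_commute)
  then show ?thesis
    using one[OF C S] one[OF C4_reflect[OF C] S] one[OF C stable3_perm(2)[OF S]]
      one[OF C4_reflect[OF C] stable3_perm(2)[OF S]] s t by blast
qed

text \<open>
  Here \<open>p\<close> lies on the far side of the edge \<open>x b\<close>, and \<open>w\<close> links \<open>p\<close> to that edge. If \<open>w\<close> missed \<open>a\<close>,
  then \<open>a\<close>, \<open>p\<close> and \<open>w\<close> would close to a hole with one or both of \<open>x\<close>, \<open>b\<close>.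
\<close>

lemma attachment_complete:
  assumes C: "C4 x a y b" and S: "stable3 x p q" and p: "nonadj p b"
    and w: "w \<sim> x \<or> w \<sim> b" "w \<sim> p" "w \<noteq> a"
  shows "w \<sim> a"
proof (rule ccontr)
  assume wa: "nonadj w a"
  note k = C[unfolded C4_def]
  note st = S[unfolded stable3_def]
  have W: "p \<in> W" "w \<in> W" "q \<in> W" using st w adj_verts by auto
  have d: "p \<noteq> y" "p \<noteq> b" "p \<noteq> a" "w \<noteq> b" using k st p w adj_sym by blast+
  have pa: "p \<sim> a" using C4_opposite[OF C4_rotate[OF C], of p] W p d by blast
  have wb: "w \<sim> b" using C4_opposite[OF C4_rotate[OF C], of w] W w wa d by blast
  show False
  proof (cases "w \<sim> x")
    case True
    have "C4 x a p w" unfolding C4_def using True k st w wa pa by (auto simp: adj_commute)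
    then show False using C4_opposite[of x a p w q] st W by (auto simp: adj_commute)
  next
    case False
    have "C5 a x b w p" unfolding C5_def using False k st w wa wb pa p by (auto simp: adj_commute)
    then show False using no_C5_if_stable3 S by blast
  qed
qed

text \<open>
  The remaining configuration has a clique cutset. Let \<open>M\<close> be the set of vertices that miss the edge
  \<open>x b\<close>; all of them see \<open>a\<close> and \<open>y\<close>. Removing the vertices \<open>U\<close> that are universal in \<open>M\<close> gives every
  vertex of \<open>M - U\<close> a partner in \<open>M\<close> with which it forms stable triples containing \<open>x\<close> or \<open>b\<close>. With
  these triples at hand, the neighbourhood of the component \<open>Q\<close> of \<open>s\<close> in \<open>M - U\<close> turns out to be a clique:
  it consists of vertices of \<open>U\<close>, of \<open>a\<close> and \<open>y\<close>, and of further neighbours of \<open>x\<close> or \<open>b\<close>.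
\<close>

lemma no_C4_if_stable3_meets:
  assumes C: "C4 x a y b" and S: "stable3 x s t" and st: "nonadj s b" "nonadj t b"
  shows False
proof -
  note k = C[unfolded C4_def]
  have C': "C4 b y a x" using C C4_rotate C4_reflect by blast
  have xb: "x \<in> W" "b \<in> W" using k adj_verts by blast+
  define M where "M = {m \<in> W. nonadj m x \<and> nonadj m b}"
  define U where "U = {u \<in> M. \<forall>m\<in>M. m \<noteq> u \<longrightarrow> u \<sim> m}"
  define Q where "Q = component_in adj (M - U) s"
  have M_ay: "m \<sim> a" "m \<sim> y" if "m \<in> M" for m
  proof -
    have "m \<noteq> a" "m \<noteq> b" "m \<noteq> x" "m \<noteq> y" using that k adj_sym unfolding M_def by blast+
    then show "m \<sim> a" "m \<sim> y"
      using C4_opposite[OF C, of m] C4_opposite[OF C', of m] that unfolding M_def by blast+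
  qed
  have sM: "s \<in> M" "t \<in> M" "s \<noteq> t" "nonadj s t"
    using S st unfolding M_def stable3_def by (auto simp: adj_commute)
  then have "s \<in> M - U" unfolding U_def by auto
  then have QM: "Q \<subseteq> M - U" unfolding Q_def by (rule component_in_subset)
  have sQ: "s \<in> Q" unfolding Q_def by (rule component_in_self)
  have conn: "cut_connected adj Q"
    unfolding Q_def by (rule component_in_connected) (use adj_sym in blast)
  have far: "nonadj x q" "nonadj b q" if "q \<in> Q" for q
    using that QM adj_sym unfolding M_def by blast+
  have mate: "\<exists>q'. stable3 x q q' \<and> stable3 b q q'" if q: "q \<in> Q" for q
  proof -
    obtain q' where q': "q' \<in> M" "q' \<noteq> q" "nonadj q q'" using q QM unfolding U_def by blast
    have "q \<in> M" using q QM by blast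
    then have "stable3 x q q' \<and> stable3 b q q'"
      using q' k xb unfolding stable3_def M_def by (auto simp: adj_commute)
    then show ?thesis by blast
  qed
  have attach: "w \<in> U \<or> w \<notin> M \<and> (w \<sim> x \<or> w \<sim> b)" if "w \<notin> Q" "w \<sim> q" "q \<in> Q" for w q
  proof -
    have "w \<in> W" using that adj_verts by blast
    moreover have "w \<notin> M - U"
      using component_in_closed[of q adj "M - U" s w] that adj_sym unfolding Q_def by blast
    ultimately show ?thesis unfolding M_def U_def by blast
  qed
  \<comment> \<open>The configuration is symmetric under exchanging \<open>x\<close> with \<open>b\<close> and \<open>a\<close> with \<open>y\<close>.\<close>
  have complete: "(w = a \<or> w \<sim> a) \<and> (w = y \<or> w \<sim> y)"
    if w: "w \<notin> M" "w \<sim> x \<or> w \<sim> b" "w \<sim> q" "q \<in> Q" for w q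
  proof -
    obtain q' where "stable3 x q q'" "stable3 b q q'" using mate w(4) by blast
    then show ?thesis
      using attachment_complete[OF C, of q q' w] attachment_complete[OF C', of q q' w]
        w far[OF w(4)] adj_sym by blast
  qed
  have U_complete: "u \<sim> w"
    if u: "u \<in> U" and w: "w \<notin> M" "w \<sim> x \<or> w \<sim> b" "w \<sim> q" "q \<in> Q" for u w q
  proof (rule ccontr)
    assume uw: "nonadj u w"
    obtain q' where q': "q' \<in> M" "q' \<noteq> q" "nonadj q q'" using w(4) QM unfolding U_def by blast
    have q: "q \<in> M" "q \<notin> U" using w(4) QM by blast+
    have "u \<in> M" "u \<noteq> q" using u q unfolding U_def by blast+
    have "u \<noteq> q'" using u q q' unfolding U_def by (auto simp: adj_commute)
    have uq: "u \<sim> q" "u \<sim> q'" using u q q' \<open>u \<noteq> q\<close> \<open>u \<noteq> q'\<close> unfolding U_def by auto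
    have "u \<noteq> w" using \<open>u \<in> M\<close> w by blast
    obtain z where z: "z = x \<or> z = b" "w \<sim> z" using w(2) by blast
    then have zM: "nonadj q z" "nonadj q' z" "nonadj u z"
      using q(1) q'(1) \<open>u \<in> M\<close> unfolding M_def by auto
    show False
    proof (cases "w \<sim> q'")
      case True
      have "C4 q u q' w" unfolding C4_def
        using True uq w(3) uw q' \<open>u \<noteq> w\<close> by (auto simp: adj_commute)
      moreover have "z \<in> W" "z \<noteq> q" "z \<noteq> q'" using z w(3) q q' k xb unfolding M_def by (auto simp: adj_commute)
      ultimately show False using C4_opposite[of q u q' w z] zM adj_sym by blast
    next
      case False
      then show False using no_P5[of z w q u q'] z zM uq uw w(3) q' by (auto simp: adj_commute)
    qed
  qed
  \<comment> \<open>Two nonadjacent attachments with a common neighbour \<open>z\<close> on the edge \<open>x b\<close> lie on a hole through \<open>Q\<close>.\<close>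
  have common: False
    if z: "z = x \<or> z = b" "w \<sim> z" "w' \<sim> z" and w: "w \<sim> q" "q \<in> Q" "w' \<sim> q'" "q' \<in> Q"
      "w \<noteq> w'" "nonadj w w'" for z w w' q q'
  proof -
    have "z \<notin> Q" using z(1) k QM unfolding M_def by (auto simp: adj_commute)
    moreover have "\<And>q. q \<in> Q \<Longrightarrow> nonadj z q" using z(1) far by blast
    ultimately consider p where "p \<in> Q" "C4 z w p w'" | p p' where "C5 z w p p' w'"
      using hole_through_connected_set[OF conn, of z w w' q q'] z w adj_sym by blast
    then show False
    proof cases
      case 1
      obtain q'' where "stable3 z p q''" using mate[OF 1(1)] z(1) by blast
      then show False using C4_opposite[OF 1(2), of q''] unfolding stable3_def by (auto simp: adj_commute)
    next
      case 2
      then show False using no_C5_if_stable3 S by blast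
    qed
  qed
  \<comment> \<open>Attachments to different ends of the edge close to a five-cycle, or \<open>b, x, w\<close> extends to a \<open>P\<^sub>5\<close> in \<open>Q\<close>.\<close>
  have cross: False
    if w: "w \<sim> x" "nonadj w b" "w' \<sim> b" "nonadj w' x" "w \<sim> q" "q \<in> Q" "w' \<sim> q'" "q' \<in> Q"
      "w \<noteq> w'" "nonadj w w'" for w w' q q'
  proof (cases "\<exists>p\<in>Q. w \<sim> p \<and> w' \<sim> p")
    case True
    then obtain p where p: "p \<in> Q" "w \<sim> p" "w' \<sim> p" by blast
    then have "C5 w x b w' p" unfolding C5_def
      using k w far[OF p(1)] by (auto simp: adj_commute)
    then show False using no_C5_if_stable3 S by blast
  next
    case False
    then have "nonadj w q'" using w by blast
    then obtain p p' where p: "p \<in> Q" "p' \<in> Q" "w \<sim> p" "nonadj w p'" "p \<sim> p'"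
      using cut_connectedD[OF conn, of q "\<lambda>z. w \<sim> z" q'] w by metis
    then show False
      using no_P5[of b x w p p'] k w far[OF p(1)] far[OF p(2)] by (auto simp: adj_commute)
  qed
  have "Q \<subseteq> W" "Q \<noteq> {}" "x \<in> W" "x \<notin> Q" using QM sQ k xb unfolding M_def by (auto simp: adj_commute)
  then obtain f f' q q' where f: "f \<notin> Q" "f' \<notin> Q" "f \<noteq> f'" "nonadj f f'"
      "q \<in> Q" "f \<sim> q" "q' \<in> Q" "f' \<sim> q'"
    using no_clique_cutset[of Q x] far by blast
  consider "f \<in> U" "f' \<in> U" | "f \<in> U" "f' \<notin> M" "f' \<sim> x \<or> f' \<sim> b"
    | "f' \<in> U" "f \<notin> M" "f \<sim> x \<or> f \<sim> b"
    | "f \<notin> M" "f' \<notin> M" "f \<sim> x \<or> f \<sim> b" "f' \<sim> x \<or> f' \<sim> b"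
    using attach[OF f(1,6,5)] attach[OF f(2,8,7)] by blast
  then show False
  proof cases
    case 1
    then show False using f(3,4) unfolding U_def by auto
  next
    case 2
    then show False using U_complete[OF 2 f(8,7)] f(4) by blast
  next
    case 3
    then show False using U_complete[OF 3 f(6,5)] f(4) adj_sym by blast
  next
    case 4
    then show False
      using common[of x f f' q q'] common[of b f f' q q'] cross[of f f' q q'] cross[of f' f q' q] f adj_sym
      by blast
  qed
qed

text \<open>
  As for five-cycles: one of two opposite vertices of the cycle lies in a stable triple, which
  leads to the configuration just excluded.
\<close>

lemma no_C4_if_stable3:
  assumes C: "C4 x a y b" and S: "stable3 s t u"
  shows False
proof -
  have W: "x \<in> W" "y \<in> W" and xy: "x \<noteq> y" "nonadj x y"
    using C adj_verts adj_sym unfolding C4_def by blast+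
  have no: False if C': "C4 p q r v" and S': "stable3 p s' t'" for p q r v s' t'
    using stable3_meeting_C4[OF C' S'] no_C4_if_stable3_meets[OF C' S']
      no_C4_if_stable3_meets[OF C4_reflect[OF C'] S'] by blast
  have "C4 y b x a" using C C4_rotate by blast
  then show False
    using stable3_or_two_neighbours[OF S W(1)] stable3_or_two_neighbours[OF S W(2)]
      no[OF C] no[of y b x a] two_neighbours_adjacent[OF S xy] by blast
qed

text \<open>
  Dirac's argument for chordal graphs: the component \<open>Q\<close> of \<open>t\<close> among the non-neighbours of \<open>s\<close> has its
  neighbourhood inside that of \<open>s\<close>, and two nonadjacent vertices there would lie on a hole.
\<close>

lemma no_stable3: "\<not> stable3 s t u"
proof
  assume S: "stable3 s t u"
  define Q where "Q = component_in adj {v \<in> W. v \<noteq> s \<and> nonadj s v} t"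
  have sub: "Q \<subseteq> {v \<in> W. v \<noteq> s \<and> nonadj s v}"
    unfolding Q_def using S by (intro component_in_subset) (auto simp: stable3_def)
  have conn: "cut_connected adj Q"
    unfolding Q_def by (rule component_in_connected) (use adj_sym in blast)
  have "t \<in> Q" unfolding Q_def by (rule component_in_self)
  moreover have sW: "s \<in> W" "s \<notin> Q" using S sub unfolding stable3_def by auto
  ultimately obtain f f' q q' where f: "f \<notin> Q" "f' \<notin> Q" "f \<noteq> f'" "nonadj f f'"
      "q \<in> Q" "f \<sim> q" "q' \<in> Q" "f' \<sim> q'"
    using no_clique_cutset[of Q s] sub by blast
  have "s \<sim> w" if "w \<notin> Q" "w \<sim> p" "p \<in> Q" for w p
  proof (rule ccontr)
    assume "nonadj s w"
    moreover have "w \<in> W" "w \<noteq> s" using that sub adj_verts by blast+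
    ultimately have "w \<in> Q"
      using component_in_closed[of p adj "{v \<in> W. v \<noteq> s \<and> nonadj s v}" t w] that adj_sym
      unfolding Q_def by blast
    then show False using that by blast
  qed
  then have "s \<sim> f" "s \<sim> f'" using f by blast+
  then show False
    using hole_through_connected_set[OF conn, of s f f' q q'] sW(2) sub f S
      no_C4_if_stable3 no_C5_if_stable3 by blast
qed

end

section \<open>Colourings\<close>

definition colourable :: "('a \<Rightarrow> 'a \<Rightarrow> bool) \<Rightarrow> 'a set \<Rightarrow> nat \<Rightarrow> bool" where
  "colourable adj W k \<longleftrightarrow>
     (\<exists>c. c ` W \<subseteq> {..<k} \<and> (\<forall>x\<in>W. \<forall>y\<in>W. adj x y \<longrightarrow> c x \<noteq> c y))"

lemma colourableI:
  assumes "finite W" "card (f ` W) \<le> k"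
    and proper: "\<And>x y. x \<in> W \<Longrightarrow> y \<in> W \<Longrightarrow> adj x y \<Longrightarrow> f x \<noteq> f y"
  shows "colourable adj W k"
proof -
  obtain g where g: "bij_betw g (f ` W) {0..<card (f ` W)}"
    using ex_bij_betw_finite_nat assms(1) by blast
  have "(g \<circ> f) ` W \<subseteq> {..<k}"
    using bij_betw_apply[OF g] assms(2) by fastforce
  moreover have "(g \<circ> f) x \<noteq> (g \<circ> f) y" if "x \<in> W" "y \<in> W" "adj x y" for x y
    using proper[OF that] inj_onD[OF bij_betw_imp_inj_on[OF g]] that by auto
  ultimately show ?thesis unfolding colourable_def by blast
qed

lemma colourable_mono: "colourable adj W k \<Longrightarrow> k \<le> l \<Longrightarrow> colourable adj W l"
  unfolding colourable_def using lessThan_subset_iff by (meson subset_trans)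

section \<open>Pairings and Gallai's lemma\<close>

text \<open>
  A matching of the complement is encoded as an involution whose fixed points are the unmatched vertices;
  it fixes everything outside \<open>W\<close>. In this form two matchings can be interchanged on any set that both
  leave invariant.
\<close>

definition nonadj_pairing :: "('a \<Rightarrow> 'a \<Rightarrow> bool) \<Rightarrow> 'a set \<Rightarrow> ('a \<Rightarrow> 'a) \<Rightarrow> bool" where
  "nonadj_pairing adj W m \<longleftrightarrow>
     (\<forall>x. m (m x) = x) \<and> (\<forall>x. x \<notin> W \<longrightarrow> m x = x) \<and> (\<forall>x\<in>W. \<not> adj x (m x))"

definition unpaired :: "'a set \<Rightarrow> ('a \<Rightarrow> 'a) \<Rightarrow> 'a set" where
  "unpaired W m = {x \<in> W. m x = x}"

definition optimal_pairing :: "('a \<Rightarrow> 'a \<Rightarrow> bool) \<Rightarrow> 'a set \<Rightarrow> ('a \<Rightarrow> 'a) \<Rightarrow> bool" where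
  "optimal_pairing adj W m \<longleftrightarrow> nonadj_pairing adj W m \<and>
     (\<forall>n. nonadj_pairing adj W n \<longrightarrow> card (unpaired W m) \<le> card (unpaired W n))"

lemma nonadj_pairing_in: "nonadj_pairing adj W m \<Longrightarrow> x \<in> W \<Longrightarrow> m x \<in> W"
  unfolding nonadj_pairing_def by metis

text \<open>
  Counting each pair \<open>{x, m x}\<close> by its members, where a fixed point counts twice.
\<close>

lemma card_pairs:
  assumes "finite W" "nonadj_pairing adj W m"
  shows "2 * card ((\<lambda>x. {x, m x}) ` W) = card W + card (unpaired W m)"
proof -
  let ?P = "(\<lambda>x. {x, m x}) ` W"
  let ?w = "\<lambda>x. if m x = x then 2 else 1 :: nat"
  have inv: "m (m x) = x" for x using assms(2) by (simp add: nonadj_pairing_def)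
  have disj: "\<forall>A\<in>?P. \<forall>B\<in>?P. A \<noteq> B \<longrightarrow> A \<inter> B = {}"
  proof (intro ballI impI)
    have class_of: "A = {z, m z}" if "A \<in> ?P" "z \<in> A" for A z
      using that inv by fastforce
    fix A B assume "A \<in> ?P" "B \<in> ?P" "A \<noteq> B"
    then show "A \<inter> B = {}" using class_of by blast
  qed
  have union: "\<Union>?P = W" using nonadj_pairing_in[OF assms(2)] by auto
  have two: "sum ?w A = 2" if A: "A \<in> ?P" for A
  proof -
    obtain x where "A = {x, m x}" using A by blast
    then show ?thesis using inv[of x] by (cases "m x = x") auto
  qed
  have "2 * card ?P = (\<Sum>A\<in>?P. sum ?w A)" using two by simp
  also have "\<dots> = sum ?w (\<Union>?P)"
    using sum.Union_disjoint[of ?P ?w] disj by simp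
  also have "\<dots> = (\<Sum>x\<in>W. 1 + (if m x = x then 1 else 0))"
    unfolding union by (rule sum.cong) auto
  also have "\<dots> = card W + card (unpaired W m)"
    using sum.inter_filter[OF assms(1), of "\<lambda>x. 1 :: nat" "\<lambda>x. m x = x"]
    by (simp add: sum_Suc unpaired_def)
  finally show ?thesis .
qed

lemma colourable_if_pairing:
  assumes "finite W" "nonadj_pairing adj W m" "card W + card (unpaired W m) \<le> 2 * k"
    and sym: "\<And>x y. adj x y \<Longrightarrow> adj y x" and irrefl: "\<And>x. \<not> adj x x"
  shows "colourable adj W k"
proof (rule colourableI[OF assms(1)])
  show "card ((\<lambda>x. {x, m x}) ` W) \<le> k" using card_pairs[OF assms(1,2)] assms(3) by linarith
  show "{x, m x} \<noteq> {y, m y}" if "x \<in> W" "y \<in> W" "adj x y" for x y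
  proof
    assume "{x, m x} = {y, m y}"
    then have "y = x \<or> y = m x" by auto
    then show False using that assms(2) irrefl unfolding nonadj_pairing_def by blast
  qed
qed

text \<open>
  Without stable triples a colour class has at most two vertices; the involution exchanges the vertices of
  a class.
\<close>

lemma pairing_if_colourable:
  assumes "finite W" "colourable adj W k"
    and no_triple: "\<And>x y z. \<lbrakk>x \<in> W; y \<in> W; z \<in> W; x \<noteq> y; x \<noteq> z; y \<noteq> z;
      \<not> adj x y; \<not> adj x z; \<not> adj y z\<rbrakk> \<Longrightarrow> False"
    and irrefl: "\<And>x. \<not> adj x x"
  shows "\<exists>m. nonadj_pairing adj W m \<and> card W + card (unpaired W m) \<le> 2 * k"
proof -
  obtain c where c: "c ` W \<subseteq> {..<k}" and p: "\<forall>x\<in>W. \<forall>y\<in>W. adj x y \<longrightarrow> c x \<noteq> c y"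
    using assms(2) by (auto simp: colourable_def)
  have proper: "c x \<noteq> c y" if "x \<in> W" "y \<in> W" "adj x y" for x y using p that by blast
  define mate where "mate x y \<longleftrightarrow> x \<in> W \<and> y \<in> W \<and> x \<noteq> y \<and> c x = c y" for x y
  have uniq: "y = z" if "mate x y" "mate x z" for x y z
    
    using no_triple[of x y z] proper[of x y] proper[of x z] proper[of y z] that
    by (auto simp: mate_def)
  have mate_sym: "mate x y \<Longrightarrow> mate y x" for x y unfolding mate_def by auto
  define m where "m x = (if \<exists>y. mate x y then SOME y. mate x y else x)" for x
  have m_mate: "m x = y" if "mate x y" for x y
    using uniq[OF someI[of "mate x", OF that] that] that by (auto simp: m_def)
  have m_alone: "m x = x" if "\<not> (\<exists>y. mate x y)" for x using that by (simp add: m_def)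
  have inv: "m (m x) = x" for x
  proof (cases "\<exists>y. mate x y")
    case True
    then obtain y where "mate x y" by blast
    then show ?thesis using m_mate mate_sym by simp
  next
    case False
    then show ?thesis using m_alone by simp
  qed
  have class_eq: "{x, m x} = {y \<in> W. c y = c x}" if x: "x \<in> W" for x
  proof (cases "\<exists>y. mate x y")
    case True
    then obtain y where y: "mate x y" by blast
    have "z = x \<or> z = y" if "z \<in> W" "c z = c x" for z
      using uniq[OF y, of z] that x unfolding mate_def by auto
    then show ?thesis using m_mate[OF y] y unfolding mate_def by auto
  next
    case False
    then show ?thesis using m_alone x unfolding mate_def by auto
  qed
  have pairing: "nonadj_pairing adj W m"
    unfolding nonadj_pairing_def
  proof (intro conjI allI impI ballI)
    show "m x = x" if "x \<notin> W" for x using m_alone that unfolding mate_def by blast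
    show "\<not> adj x (m x)" if "x \<in> W" for x
    proof -
      have "m x \<in> {y \<in> W. c y = c x}" using class_eq[OF that] by blast
      then show ?thesis using proper[OF that, of "m x"] by auto
    qed
  qed (rule inv)
  have "(\<lambda>x. {x, m x}) ` W = (\<lambda>i. {y \<in> W. c y = i}) ` (c ` W)"
    using class_eq by (auto simp: image_image intro!: image_cong)
  then have "card ((\<lambda>x. {x, m x}) ` W) \<le> card (c ` W)"
    using card_image_le[OF finite_imageI[OF assms(1)]] by simp
  also have "\<dots> \<le> k" using card_mono[OF _ c] by simp
  finally show ?thesis using pairing card_pairs[OF assms(1) pairing] by auto
qed

text \<open>
  The union of two matchings \<open>m\<close> and \<open>n\<close> consists of paths and cycles; the set \<open>P\<close> is the path that
  starts at the vertex \<open>u\<close> missed by \<open>m\<close>. If \<open>P\<close> contains a vertex missed by \<open>n\<close>, this is the other end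
  of the path, and \<open>u\<close> is the only vertex of \<open>P\<close> missed by \<open>m\<close>. Algebraically, \<open>P\<close> is the orbit of \<open>u\<close>
  under \<open>f = m \<circ> n\<close>. The involution \<open>m\<close> maps \<open>f\<^sup>i u\<close> to \<open>f\<^sup>-\<^sup>i u\<close>, and \<open>n\<close> maps it to \<open>f\<^sup>-\<^sup>i\<^sup>-\<^sup>1 u\<close>. So a fixed
  point \<open>f\<^sup>k u\<close> of \<open>n\<close> forces the period of \<open>u\<close> to divide \<open>2 k + 1\<close>, hence to be odd, while a fixed point
  \<open>f\<^sup>j u\<close> of \<open>m\<close> forces it to divide \<open>2 j\<close>, hence \<open>j\<close>.
\<close>

lemma involutions_orbit:
  fixes m n :: "'a \<Rightarrow> 'a"
  assumes inv: "\<And>x. m (m x) = x" "\<And>x. n (n x) = x"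
    and W: "finite W" "\<And>x. x \<in> W \<Longrightarrow> m x \<in> W" "\<And>x. x \<in> W \<Longrightarrow> n x \<in> W"
    and u: "u \<in> W" "m u = u"
  shows "\<exists>P. u \<in> P \<and> (\<forall>x\<in>P. m x \<in> P \<and> n x \<in> P) \<and>
    (\<forall>t\<in>P. \<forall>v\<in>P. n t = t \<longrightarrow> m v = v \<longrightarrow> v = u)"
proof -
  define f where "f = m \<circ> n"
  define g where "g = n \<circ> m"
  have f: "f x = m (n x)" and g: "g x = n (m x)" for x by (simp_all add: f_def g_def)
  define P where "P = range (\<lambda>i. (f ^^ i) u)"
  have mf: "m ((f ^^ i) x) = (g ^^ i) (m x)" for i x
  proof (induction i)
    case (Suc i)
    have "(g ^^ Suc i) (m x) = g (m ((f ^^ i) x))" using Suc by simp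
    moreover have "m ((f ^^ Suc i) x) = n ((f ^^ i) x)"
      using f[of "(f ^^ i) x"] inv(1) by simp
    ultimately show ?case using g[of "m ((f ^^ i) x)"] inv(1) by simp
  qed simp
  have gf: "(g ^^ i) ((f ^^ i) x) = x" for i x
  proof (induction i arbitrary: x)
    case (Suc i)
    have "(g ^^ Suc i) ((f ^^ Suc i) x) = (g ^^ i) (g (f ((f ^^ i) x)))" by (simp add: funpow_swap1)
    moreover have "g (f y) = y" for y unfolding f g by (simp add: inv)
    ultimately show ?case using Suc by simp
  qed simp
  have fg: "(f ^^ i) ((g ^^ i) x) = x" for i x
  proof (induction i arbitrary: x)
    case (Suc i)
    have "(f ^^ Suc i) ((g ^^ Suc i) x) = (f ^^ i) (f (g ((g ^^ i) x)))" by (simp add: funpow_swap1)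
    moreover have "f (g y) = y" for y unfolding f g by (simp add: inv)
    ultimately show ?case using Suc by simp
  qed simp
  have inj: "inj f" by (rule inj_on_inverseI[of _ g]) (use f g inv in metis)
  have PW: "(f ^^ i) u \<in> W" for i by (induction i) (use f u W in auto)
  have "finite {y. \<exists>i. y = (f ^^ i) u}" by (rule finite_subset[OF _ W(1)]) (use PW in auto)
  with inj obtain N where N: "N > 0" "(f ^^ N) u = u" by (rule funpow_inj_finite)
  have period: "(f ^^ (p * i)) u = u" if "(f ^^ p) u = u" for p i
    using that by (induction i) (simp_all add: funpow_add)
  have g_in: "(g ^^ i) u \<in> P" for i
  proof -
    have "(f ^^ (i * N)) u = u" using period[OF N(2), of i] by (simp add: mult.commute)
    moreover have "i * N = i + (i * N - i)" using N(1) by simp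
    ultimately have "(f ^^ i) ((f ^^ (i * N - i)) u) = u" by (metis comp_apply funpow_add)
    then have "(g ^^ i) u = (f ^^ (i * N - i)) u" using gf by metis
    then show ?thesis by (auto simp: P_def)
  qed
  have n_eq: "n x = m (f x)" for x using f inv(1) by metis
  have step: "n ((f ^^ i) u) = (g ^^ Suc i) u" for i
    using mf[of "Suc i" u] u n_eq[of "(f ^^ i) u"] by simp
  show ?thesis
  proof (intro exI[of _ P] conjI ballI impI)
    show "u \<in> P" unfolding P_def by (metis funpow_0 rangeI)
    show "m x \<in> P" if "x \<in> P" for x using that g_in mf u unfolding P_def by auto
    show "n x \<in> P" if "x \<in> P" for x
    proof -
      from that obtain i where "x = (f ^^ i) u" by (auto simp: P_def)
      then show ?thesis using g_in[of "Suc i"] step[of i] by metis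
    qed
    show "v = u" if "t \<in> P" "n t = t" "v \<in> P" "m v = v" for t v
    proof -
      obtain j k where v: "v = (f ^^ j) u" and t: "t = (f ^^ k) u" using \<open>v \<in> P\<close> \<open>t \<in> P\<close> by (auto simp: P_def)
      have "v = (g ^^ j) u" using mf[of j u] v u that by simp
      then have "(f ^^ j) v = u" using fg by simp
      then have j: "(f ^^ (2 * j)) u = u" using v by (simp add: funpow_add mult_2)
      have "t = (g ^^ Suc k) u" using step[of k] t that by simp
      then have "(f ^^ Suc k) t = u" using fg by metis
      then have k: "(f ^^ (2 * k + 1)) u = u" using t by (simp add: funpow_add mult_2)
      let ?N = "least_power f u"
      have "?N dvd 2 * j" "?N dvd 2 * k + 1" using least_power_minimal j k by metis+
      moreover from this have "odd ?N" using dvd_trans[of 2 ?N "2 * k + 1"] by auto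
      then have "coprime ?N 2" by (simp add: coprime_right_2_iff_odd)
      ultimately have "?N dvd j" by (simp add: coprime_dvd_mult_right_iff)
      then obtain i where "j = ?N * i" by blast
      moreover have "(f ^^ ?N) u = u" using least_powerI N by metis
      ultimately show "v = u" using v period by metis
    qed
  qed
qed


text \<open>
  Gallai's lemma, stated for the complement. Call two vertices related if no optimal pairing misses both.
  Nonadjacent vertices are related, since they could be paired. The point is that the relation is
  transitive; then connectivity of the complement makes all vertices related. For transitivity suppose
  that \<open>m\<close> misses \<open>u\<close> and \<open>v\<close>, and let \<open>n\<close> miss the intermediate vertex \<open>t\<close>. Exchange \<open>m\<close> and \<open>n\<close> on the path
  \<open>P\<close> that starts at \<open>u\<close>. Optimality of both pairings shows that the results are optimal too. If \<open>t\<close> is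
  on \<open>P\<close>, then \<open>v\<close> is not, and one of the results misses \<open>t\<close> and \<open>v\<close>; otherwise the other one misses
  \<open>t\<close> and \<open>u\<close>.
\<close>

lemma gallai_pairing:
  assumes "finite W"
    and sym: "\<And>x y. adj x y \<Longrightarrow> adj y x" and irrefl: "\<And>x. \<not> adj x x"
    and co_connected: "cut_connected (\<lambda>x y. \<not> adj x y) W"
    and inessential: "\<And>v. v \<in> W \<Longrightarrow> \<exists>m. optimal_pairing adj W m \<and> m v = v"
    and m: "optimal_pairing adj W m"
  shows "card (unpaired W m) \<le> 1"
proof -
  define rel where "rel u v \<longleftrightarrow> u = v \<or> \<not> (\<exists>m. optimal_pairing adj W m \<and> m u = u \<and> m v = v)" for u v
  have fin: "finite (unpaired W m)" for m using assms(1) by (simp add: unpaired_def)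
  have rel_edge: "rel u v" if uv: "u \<in> W" "v \<in> W" "\<not> adj u v" for u v
    unfolding rel_def
  proof (rule ccontr)
    assume "\<not> (u = v \<or> \<not> (\<exists>m. optimal_pairing adj W m \<and> m u = u \<and> m v = v))"
    then obtain m where ne: "u \<noteq> v" and m: "optimal_pairing adj W m" "m u = u" "m v = v" by blast
    let ?m = "m(u := v, v := u)"
    have pm: "nonadj_pairing adj W m" using m by (simp add: optimal_pairing_def)
    have other: "m x \<noteq> u \<and> m x \<noteq> v" if "x \<noteq> u" "x \<noteq> v" for x
      using pm m(2,3) that unfolding nonadj_pairing_def by metis
    have "nonadj_pairing adj W ?m"
      using pm other uv sym[of v u] unfolding nonadj_pairing_def by auto
    then have "card (unpaired W m) \<le> card (unpaired W ?m)"
      using m by (simp add: optimal_pairing_def)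
    moreover have "unpaired W ?m \<subset> unpaired W m"
      using ne m uv unfolding unpaired_def by auto
    ultimately show False using psubset_card_mono[OF fin] by (metis not_le)
  qed
  have rel_trans: "rel u v" if rel: "rel u t" "rel t v" and W: "u \<in> W" "t \<in> W" "v \<in> W" for u t v
  proof (rule ccontr)
    assume "\<not> rel u v"
    then obtain m where ne: "u \<noteq> v" and m: "optimal_pairing adj W m" "m u = u" "m v = v"
      unfolding rel_def by blast
    obtain n where n: "optimal_pairing adj W n" "n t = t" using inessential[OF W(2)] by blast
    have tu: "t \<noteq> u" "t \<noteq> v" using rel \<open>\<not> rel u v\<close> by auto
    have pm: "nonadj_pairing adj W m" and pn: "nonadj_pairing adj W n"
      using m n by (simp_all add: optimal_pairing_def)
    have inv: "m (m x) = x" "n (n x) = x" for x using pm pn by (simp_all add: nonadj_pairing_def)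
    obtain P where P: "u \<in> P" "\<And>x. x \<in> P \<Longrightarrow> m x \<in> P" "\<And>x. x \<in> P \<Longrightarrow> n x \<in> P"
      and parity: "\<And>t v. \<lbrakk>t \<in> P; n t = t; v \<in> P; m v = v\<rbrakk> \<Longrightarrow> v = u"
      using involutions_orbit[of m n W u, OF inv assms(1) nonadj_pairing_in[OF pm]
            nonadj_pairing_in[OF pn] W(1) m(2)] by auto
    define switch where "switch a b x = (if x \<in> P then a x else b x)" for a b :: "'a \<Rightarrow> 'a" and x
    have switch_pairing: "nonadj_pairing adj W (switch a b)"
      if "nonadj_pairing adj W a" "nonadj_pairing adj W b"
        "\<And>x. x \<in> P \<Longrightarrow> a x \<in> P" "\<And>x. x \<in> P \<Longrightarrow> b x \<in> P" for a b
    proof -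
      have "b x \<notin> P" if "x \<notin> P" for x
        using that \<open>\<And>x. x \<in> P \<Longrightarrow> b x \<in> P\<close> \<open>nonadj_pairing adj W b\<close>
        unfolding nonadj_pairing_def by metis
      then show ?thesis using that unfolding nonadj_pairing_def switch_def by auto
    qed
    have pmn: "nonadj_pairing adj W (switch m n)" and pnm: "nonadj_pairing adj W (switch n m)"
      using switch_pairing pm pn P by blast+
    have split_switch: "card (unpaired W (switch a b)) = card (unpaired W a \<inter> P) + card (unpaired W b - P)" for a b
    proof -
      have "unpaired W (switch a b) = (unpaired W a \<inter> P) \<union> (unpaired W b - P)"
        by (auto simp: unpaired_def switch_def)
      then show ?thesis using fin by (simp add: card_Un_disjoint Int_Diff disjoint_iff)
    qed
    have split: "card (unpaired W a) = card (unpaired W a \<inter> P) + card (unpaired W a - P)" for a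
      using card_Int_Diff[OF fin] by simp
    have "card (unpaired W m) \<le> card (unpaired W (switch n m))"
      "card (unpaired W n) \<le> card (unpaired W (switch m n))"
      using m n pmn pnm by (simp_all add: optimal_pairing_def)
    then have "card (unpaired W (switch n m)) \<le> card (unpaired W m)"
      "card (unpaired W (switch m n)) \<le> card (unpaired W n)"
      unfolding split_switch split[of m] split[of n] by linarith+
    then have opt: "optimal_pairing adj W (switch n m)" "optimal_pairing adj W (switch m n)"
      using m n pmn pnm unfolding optimal_pairing_def by (meson le_trans)+
    show False
    proof (cases "t \<in> P")
      case True
      then have "v \<notin> P" using parity n(2) m(3) ne by blast
      then have "switch n m t = t" "switch n m v = v" using True n m by (simp_all add: switch_def)
      then show False using opt(1) rel(2) tu(2) unfolding rel_def by blast
    next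
      case False
      then have "switch m n t = t" "switch m n u = u" using P n m by (simp_all add: switch_def)
      then show False using opt(2) rel(1) tu(1) unfolding rel_def by blast
    qed
  qed
  have all: "rel u v" if uv: "u \<in> W" "v \<in> W" for u v
  proof (rule ccontr)
    assume "\<not> rel u v"
    moreover have "rel u u" by (simp add: rel_def)
    ultimately obtain p q where "p \<in> W" "q \<in> W" "rel u p" "\<not> rel u q" "\<not> adj p q"
      using cut_connectedD[OF co_connected uv(1), of "rel u" v] uv by metis
    then show False using rel_edge rel_trans uv by blast
  qed
  have "u = v" if "u \<in> unpaired W m" "v \<in> unpaired W m" for u v
    using all[of u v] that m unfolding rel_def unpaired_def by blast
  then show ?thesis using fin by (simp add: card_le_Suc0_iff_eq)
qed

text \<open>
  A colouring of \<open>W - {v}\<close> with \<open>k\<close> colours gives a pairing that misses \<open>v\<close> and at most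
  \<open>2 k + 2 - |W|\<close> vertices in total. No pairing misses fewer, because \<open>W\<close> has no colouring with \<open>k\<close> colours
  and the number of missed vertices has the parity of \<open>|W|\<close>.
\<close>

lemma critical_colourable_half:
  assumes "finite W" "W \<noteq> {}"
    and sym: "\<And>x y. adj x y \<Longrightarrow> adj y x" and irrefl: "\<And>x. \<not> adj x x"
    and co_connected: "cut_connected (\<lambda>x y. \<not> adj x y) W"
    and no_triple: "\<And>x y z. \<lbrakk>x \<in> W; y \<in> W; z \<in> W; x \<noteq> y; x \<noteq> z; y \<noteq> z;
      \<not> adj x y; \<not> adj x z; \<not> adj y z\<rbrakk> \<Longrightarrow> False"
    and critical: "\<And>v. v \<in> W \<Longrightarrow> colourable adj (W - {v}) k" "\<not> colourable adj W k"
  shows "colourable adj W ((card W + 1) div 2)"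
proof -
  have inessential: "\<exists>m. optimal_pairing adj W m \<and> m v = v" if v: "v \<in> W" for v
  proof -
    obtain m where m: "nonadj_pairing adj (W - {v}) m"
      "card (W - {v}) + card (unpaired (W - {v}) m) \<le> 2 * k"
      using pairing_if_colourable[OF _ critical(1)[OF v]] assms(1) no_triple irrefl by blast
    have mv: "m v = v" using m(1) by (simp add: nonadj_pairing_def)
    have pm: "nonadj_pairing adj W m" using m(1) mv irrefl unfolding nonadj_pairing_def by auto
    have "unpaired W m = insert v (unpaired (W - {v}) m)" using mv v by (auto simp: unpaired_def)
    then have "card (unpaired W m) = Suc (card (unpaired (W - {v}) m))"
      using assms(1) by (simp add: unpaired_def)
    moreover have "card W = Suc (card (W - {v}))" using assms(1) v by (metis card.remove)
    ultimately have small: "card W + card (unpaired W m) \<le> 2 * k + 2" using m(2) by linarith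
    have "card (unpaired W m) \<le> card (unpaired W n)" if n: "nonadj_pairing adj W n" for n
    proof -
      have "\<not> card W + card (unpaired W n) \<le> 2 * k"
        using colourable_if_pairing[OF assms(1) n] sym irrefl critical(2) by blast
      then show ?thesis using card_pairs[OF assms(1) n] small by presburger
    qed
    then show ?thesis using pm mv unfolding optimal_pairing_def by blast
  qed
  then obtain m where m: "optimal_pairing adj W m" using assms(2) by blast
  then have pm: "nonadj_pairing adj W m" by (simp add: optimal_pairing_def)
  have "card (unpaired W m) \<le> 1"
    using gallai_pairing[OF assms(1) sym irrefl co_connected inessential m] by blast
  then have "card W + card (unpaired W m) \<le> 2 * ((card W + 1) div 2)"
    using card_pairs[OF assms(1) pm] by presburger
  then show ?thesis using colourable_if_pairing[OF assms(1) pm _ sym irrefl] by blast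
qed

section \<open>Colour-critical graphs\<close>

lemma colourable_subset: "colourable adj W k \<Longrightarrow> A \<subseteq> W \<Longrightarrow> colourable adj A k"
  unfolding colourable_def by (meson image_mono subset_iff subset_trans)

lemma colourable_card:
  assumes "finite W" and irrefl: "\<And>x. \<not> adj x x"
  shows "colourable adj W (card W)"
  by (rule colourableI[OF assms(1), of "\<lambda>x. x"]) (use irrefl in auto)

lemma colourable_Un:
  assumes "colourable adj A k" "colourable adj B l" and sym: "\<And>x y. adj x y \<Longrightarrow> adj y x"
  shows "colourable adj (A \<union> B) (k + l)"
proof -
  obtain c where c: "c ` A \<subseteq> {..<k}" "\<forall>x\<in>A. \<forall>y\<in>A. adj x y \<longrightarrow> c x \<noteq> c y"
    using assms(1) by (auto simp: colourable_def)
  obtain d where d: "d ` B \<subseteq> {..<l}" "\<forall>x\<in>B. \<forall>y\<in>B. adj x y \<longrightarrow> d x \<noteq> d y"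
    using assms(2) by (auto simp: colourable_def)
  define e where "e x = (if x \<in> A then c x else k + d x)" for x
  have "e ` (A \<union> B) \<subseteq> {..<k + l}" using c(1) d(1) by (auto simp: e_def image_subset_iff)
  moreover have "e x \<noteq> e y" if "x \<in> A \<union> B" "y \<in> A \<union> B" "adj x y" for x y
    using that c d by (auto simp: e_def image_subset_iff dest: sym)
  ultimately show ?thesis unfolding colourable_def by blast
qed

lemma bij_betw_extend:
  assumes "finite S" "X \<subseteq> S" "Y \<subseteq> S" "bij_betw g X Y"
  obtains h where "bij_betw h S S" "\<And>x. x \<in> X \<Longrightarrow> h x = g x"
proof -
  have "card X = card Y" using bij_betw_same_card[OF assms(4)] .
  then have "card (S - X) = card (S - Y)"
    using assms(1-3) by (simp add: card_Diff_subset finite_subset)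
  then obtain f where f: "bij_betw f (S - X) (S - Y)"
    using assms(1) by (meson finite_Diff finite_same_card_bij)
  define h where "h x = (if x \<in> X then g x else f x)" for x
  have "bij_betw h X Y" using assms(4) by (rule bij_betw_cong[THEN iffD1, rotated]) (simp add: h_def)
  moreover have "bij_betw h (S - X) (S - Y)"
    using f by (rule bij_betw_cong[THEN iffD1, rotated]) (simp add: h_def)
  ultimately have "bij_betw h (X \<union> (S - X)) (Y \<union> (S - Y))" by (rule bij_betw_combine) auto
  then have "bij_betw h S S" using assms(2,3) by (simp add: Un_absorb1)
  then show thesis using that by (simp add: h_def)
qed

text \<open>
  On the separating clique both colourings are injective, so a permutation of the colours makes them agree.
\<close>

lemma colourable_glue:
  assumes sym: "\<And>x y. adj x y \<Longrightarrow> adj y x"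
    and A: "colourable adj (Q \<union> K) k" and B: "colourable adj (W - Q) k"
    and K: "K \<subseteq> W - Q" "\<And>x y. x \<in> K \<Longrightarrow> y \<in> K \<Longrightarrow> x \<noteq> y \<Longrightarrow> adj x y"
    and sep: "\<And>x q. x \<in> W - Q \<Longrightarrow> q \<in> Q \<Longrightarrow> adj x q \<Longrightarrow> x \<in> K"
  shows "colourable adj W k"
proof -
  obtain c where c: "c ` (Q \<union> K) \<subseteq> {..<k}" "\<forall>x\<in>Q \<union> K. \<forall>y\<in>Q \<union> K. adj x y \<longrightarrow> c x \<noteq> c y"
    using A by (auto simp: colourable_def)
  obtain d where d: "d ` (W - Q) \<subseteq> {..<k}" "\<forall>x\<in>W - Q. \<forall>y\<in>W - Q. adj x y \<longrightarrow> d x \<noteq> d y"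
    using B by (auto simp: colourable_def)
  have "inj_on c K" "inj_on d K" unfolding inj_on_def using c(2) d(2) K by blast+
  then have "bij_betw (c \<circ> the_inv_into K d) (d ` K) (c ` K)"
    by (meson bij_betw_the_inv_into bij_betw_trans inj_on_imp_bij_betw)
  moreover have "d ` K \<subseteq> {..<k}" "c ` K \<subseteq> {..<k}" using c(1) d(1) K(1) by auto
  ultimately obtain h where h: "bij_betw h {..<k} {..<k}"
    "\<And>x. x \<in> d ` K \<Longrightarrow> h x = (c \<circ> the_inv_into K d) x"
    using bij_betw_extend[of "{..<k}"] by (metis finite_lessThan)
  have hd: "h (d x) = c x" if "x \<in> K" for x
    using h(2)[of "d x"] that \<open>inj_on d K\<close> by (simp add: the_inv_into_f_f)
  define e where "e x = (if x \<in> Q then c x else h (d x))" for x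
  have eK: "e x = c x" if "x \<in> Q \<union> K" for x using that hd by (auto simp: e_def)
  have range: "e ` W \<subseteq> {..<k}"
  proof
    fix i assume "i \<in> e ` W"
    then obtain x where x: "x \<in> W" "i = e x" by blast
    show "i \<in> {..<k}"
    proof (cases "x \<in> Q")
      case True
      then show ?thesis using x c(1) by (auto simp: e_def)
    next
      case False
      then have "d x \<in> {..<k}" using x d(1) by blast
      then show ?thesis using False x bij_betw_apply[OF h(1)] by (simp add: e_def)
    qed
  qed
  have proper: "e x \<noteq> e y" if "x \<in> W" "y \<in> W" "adj x y" for x y
  proof (cases "x \<in> Q \<or> y \<in> Q")
    case True
    then have "x \<in> Q \<union> K" "y \<in> Q \<union> K" using that sep sym by blast+
    then show ?thesis using eK c(2) that by simp
  next
    case False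
    then have "d x \<noteq> d y" "d x \<in> {..<k}" "d y \<in> {..<k}" using d that by blast+
    then show ?thesis using False bij_betw_imp_inj_on[OF h(1)] by (auto simp: e_def inj_on_def)
  qed
  show ?thesis unfolding colourable_def using range proper by blast
qed

lemma critical_no_clique_cutset:
  assumes sym: "\<And>x y. adj x y \<Longrightarrow> adj y x"
    and critical: "\<And>v. v \<in> W \<Longrightarrow> colourable adj (W - {v}) k" "\<not> colourable adj W k"
    and Q: "Q \<subseteq> W" "Q \<noteq> {}" and r: "r \<in> W" "r \<notin> Q" "\<And>q. q \<in> Q \<Longrightarrow> \<not> adj r q"
  shows "\<exists>f\<in>W - Q. \<exists>f'\<in>W - Q. \<exists>q\<in>Q. \<exists>q'\<in>Q. f \<noteq> f' \<and> \<not> adj f f' \<and> adj f q \<and> adj f' q'"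
proof (rule ccontr)
  assume none: "\<not> ?thesis"
  define K where "K = {f \<in> W - Q. \<exists>q\<in>Q. adj f q}"
  obtain q where "q \<in> Q" using Q by blast
  have "colourable adj (Q \<union> K) k"
    by (rule colourable_subset[OF critical(1)[OF r(1)]]) (use Q r in \<open>auto simp: K_def\<close>)
  moreover have "colourable adj (W - Q) k"
    by (rule colourable_subset[OF critical(1)[of q]]) (use Q \<open>q \<in> Q\<close> in auto)
  ultimately have "colourable adj W k"
  proof (rule colourable_glue[rotated])
    show "adj y x" if "adj x y" for x y using sym that .
    show "adj x y" if "x \<in> K" "y \<in> K" "x \<noteq> y" for x y
      using none that unfolding K_def by blast
  qed (auto simp: K_def)
  then show False using critical(2) by blast
qed

definition clique_in :: "('a \<Rightarrow> 'a \<Rightarrow> bool) \<Rightarrow> 'a set \<Rightarrow> 'a set \<Rightarrow> bool" where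
  "clique_in adj W K \<longleftrightarrow> K \<subseteq> W \<and> (\<forall>x\<in>K. \<forall>y\<in>K. x \<noteq> y \<longrightarrow> adj x y)"

text \<open>
  The inequality \<open>2 \<chi> \<le> n + \<omega>\<close>: a nonadjacent pair can share one new colour, and removing it
  lowers \<open>n\<close> by two; if there is no such pair, the graph is complete.
\<close>

lemma colourable_half_card_plus_clique:
  assumes "finite W" and sym: "\<And>x y. adj x y \<Longrightarrow> adj y x" and irrefl: "\<And>x. \<not> adj x x"
  shows "\<exists>K. clique_in adj W K \<and> colourable adj W ((card W + card K) div 2)"
  using assms(1)
proof (induction W rule: finite_psubset_induct)
  case (psubset W)
  show ?case
  proof (cases "clique_in adj W W")
    case True
    then show ?thesis using colourable_card[of W adj, OF psubset.hyps irrefl] by (intro exI[of _ W]) auto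
  next
    case False
    then obtain x y where xy: "x \<in> W" "y \<in> W" "x \<noteq> y" "\<not> adj x y" unfolding clique_in_def by blast
    let ?W = "W - {x, y}"
    have "?W \<subset> W" using xy by blast
    then obtain K where K: "clique_in adj ?W K" "colourable adj ?W ((card ?W + card K) div 2)"
      using psubset.IH by blast
    have "card W = card ?W + 2"
      using xy psubset.hyps card_Diff_subset[of "{x, y}" W] card_mono[of W "{x, y}"] by simp
    moreover have "colourable adj {x, y} 1"
      by (rule colourableI[of _ "\<lambda>_. ()"]) (use xy irrefl sym in auto)
    then have "colourable adj (?W \<union> {x, y}) ((card ?W + card K) div 2 + 1)"
      using colourable_Un[OF K(2)] sym by blast
    moreover have "?W \<union> {x, y} = W" using xy by blast
    moreover have "clique_in adj W K" using K(1) unfolding clique_in_def by blast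
    ultimately show ?thesis by (intro exI[of _ K]) (simp add: algebra_simps)
  qed
qed

section \<open>The degree and clique bound\<close>

text \<open>
  Induced subgraphs are formed by restricting adjacency, because the locales demand that adjacency implies
  membership.
\<close>

definition induced :: "'a set \<Rightarrow> ('a \<Rightarrow> 'a \<Rightarrow> bool) \<Rightarrow> 'a \<Rightarrow> 'a \<Rightarrow> bool" where
  "induced A adj x y \<longleftrightarrow> adj x y \<and> x \<in> A \<and> y \<in> A"

lemma colourable_induced: "colourable (induced A adj) A k \<longleftrightarrow> colourable adj A k"
  by (simp add: colourable_def induced_def)

lemma P5_banner_free_graph_induced:
  assumes "P5_banner_free_graph W adj"
  shows "P5_banner_free_graph A (induced A adj)"
proof -
  interpret P5_banner_free_graph W adj by fact
  show ?thesis
  proof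
    show "induced A adj y x" if "induced A adj x y" for x y
      using that adj_sym unfolding induced_def by blast
    show "\<not> induced A adj x x" for x using adj_irrefl unfolding induced_def by blast
    show "x \<in> A" if "induced A adj x y" for x y using that unfolding induced_def by blast
  next
    fix a b c d e
    assume "induced A adj a b" "induced A adj b c" "induced A adj c d" "induced A adj d e"
      "\<not> induced A adj a c" "\<not> induced A adj a d" "\<not> induced A adj a e" "\<not> induced A adj b d"
      "\<not> induced A adj b e" "\<not> induced A adj c e"
    then show False using no_P5[of a b c d e] by (simp add: induced_def)
  next
    fix a b c d e
    assume "induced A adj a b" "induced A adj b c" "induced A adj c d" "induced A adj d a"
      "induced A adj a e" "b \<noteq> d" "\<not> induced A adj a c" "\<not> induced A adj b d"
      "\<not> induced A adj e b" "\<not> induced A adj e c" "\<not> induced A adj e d"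
    then show False using no_banner[of a b c d e] by (simp add: induced_def)
  qed
qed

text \<open>
  The non-neighbours of a vertex \<open>v\<close> form a clique \<open>K\<close> with \<open>n = 1 + d(v) + |K|\<close>, and \<open>2 \<chi> \<le> n + 1\<close>.
\<close>

lemma reed_bound_critical:
  assumes "P5_banner_free_graph W adj" "finite W" "W \<noteq> {}"
    and critical: "\<And>v. v \<in> W \<Longrightarrow> colourable adj (W - {v}) k" "\<not> colourable adj W k"
    and co_connected: "cut_connected (\<lambda>x y. \<not> adj x y) W"
  shows "\<exists>v\<in>W. \<exists>K. clique_in adj W K \<and> colourable adj W ((card {u. adj v u} + card K + 2) div 2)"
proof -
  interpret P5_banner_free_graph W adj by fact
  interpret indecomposable_P5_banner_free_graph W adj
  proof
    show "\<exists>f f' q q'. f \<notin> Q \<and> f' \<notin> Q \<and> f \<noteq> f' \<and> nonadj f f' \<and> q \<in> Q \<and> adj f q \<and> q' \<in> Q \<and> adj f' q'"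
      if "Q \<subseteq> W" "Q \<noteq> {}" "r \<in> W" "r \<notin> Q" "\<And>q. q \<in> Q \<Longrightarrow> nonadj r q" for Q r
      using critical_no_clique_cutset[OF adj_sym critical that] by blast
  qed (use assms in auto)
  have no_triple: False
    if "x \<in> W" "y \<in> W" "z \<in> W" "x \<noteq> y" "x \<noteq> z" "y \<noteq> z" "nonadj x y" "nonadj x z" "nonadj y z" for x y z
    using no_stable3[of x y z] that by (simp add: stable3_def)
  have half: "colourable adj W ((card W + 1) div 2)"
    by (rule critical_colourable_half[where k = k])
      (fact assms(2,3) adj_sym adj_irrefl co_connected no_triple critical)+
  obtain v where v: "v \<in> W" using assms(3) by blast
  define K where "K = {u \<in> W. u \<noteq> v \<and> nonadj v u}"
  have "clique_in adj W K"
    unfolding clique_in_def K_def using no_triple v by blast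
  moreover have "W = insert v ({u. adj v u} \<union> K)" using v adj_verts2 unfolding K_def by blast
  then have "card W = Suc (card ({u. adj v u} \<union> K))"
    using assms(2) adj_irrefl by (metis (mono_tags, lifting) K_def UnE card_insert_disjoint finite_insert mem_Collect_eq)
  then have "card W + 1 \<le> card {u. adj v u} + card K + 2"
    using card_Un_le[of "{u. adj v u}" K] by linarith
  then have "colourable adj W ((card {u. adj v u} + card K + 2) div 2)"
    using half by (meson colourable_mono div_le_mono)
  ultimately show ?thesis using v by blast
qed

text \<open>
  Naming a vertex and a clique instead of \<open>\<Delta>\<close> and \<open>\<omega>\<close> makes the bound easy to transport: from a
  subgraph the vertex and the clique are kept, and in a join the two cliques are united. The colour bound
  \<open>\<lceil>(\<Delta> + \<omega> + 1) / 2\<rceil>\<close> is written as \<open>(\<Delta> + \<omega> + 2) div 2\<close>.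
\<close>

lemma reed_bound:
  assumes "P5_banner_free_graph W adj" "finite W" "W \<noteq> {}"
  shows "\<exists>v\<in>W. \<exists>K. clique_in adj W K \<and> colourable adj W ((card {u. adj v u} + card K + 2) div 2)"
  using assms
proof (induction "card W" arbitrary: W adj rule: less_induct)
  case less
  interpret P5_banner_free_graph W adj by fact
  note fin = \<open>finite W\<close>
  have fin_nbrs: "finite {u. adj v u}" for v
    by (rule finite_subset[OF _ fin]) (use adj_verts2 in blast)
  have IH: "\<exists>v\<in>A. \<exists>K. clique_in adj A K \<and> colourable adj A ((card {u \<in> A. adj v u} + card K + 2) div 2)"
    if A: "A \<subset> W" "A \<noteq> {}" for A
  proof -
    have "\<exists>v\<in>A. \<exists>K. clique_in (induced A adj) A K \<and>
        colourable (induced A adj) A ((card {u. induced A adj v u} + card K + 2) div 2)"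
      by (rule less.hyps)
        (use A fin P5_banner_free_graph_induced[OF less.prems(1)] in
          \<open>auto intro: psubset_card_mono finite_subset\<close>)
    then obtain v K where v: "v \<in> A" and K: "clique_in (induced A adj) A K"
      and c: "colourable adj A ((card {u. induced A adj v u} + card K + 2) div 2)"
      by (auto simp: colourable_induced)
    have "{u. induced A adj v u} = {u \<in> A. adj v u}" using v by (auto simp: induced_def)
    moreover have "clique_in adj A K" using K unfolding clique_in_def induced_def by blast
    ultimately show ?thesis using v c by auto
  qed
  show ?case
  proof (cases "\<exists>v\<in>W. \<forall>k. colourable adj (W - {v}) k \<longrightarrow> colourable adj W k")
    case True
    then obtain v where v: "v \<in> W" "\<And>k. colourable adj (W - {v}) k \<Longrightarrow> colourable adj W k" by blast
    have "W - {v} \<noteq> {}"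
    proof
      assume "W - {v} = {}"
      moreover have "colourable adj {} 0" by (simp add: colourable_def)
      ultimately have "colourable adj W 0" using v(2)[of 0] by argo
      then show False using v(1) by (auto simp: colourable_def)
    qed
    then obtain w K where w: "w \<in> W - {v}" "clique_in adj (W - {v}) K"
      "colourable adj (W - {v}) ((card {u \<in> W - {v}. adj w u} + card K + 2) div 2)"
      using IH[of "W - {v}"] v(1) by blast
    have "card {u \<in> W - {v}. adj w u} \<le> card {u. adj w u}" by (rule card_mono[OF fin_nbrs]) blast
    then have "colourable adj W ((card {u. adj w u} + card K + 2) div 2)"
      using v(2)[OF w(3)] by (elim colourable_mono) (simp add: div_le_mono)
    then show ?thesis using w unfolding clique_in_def by blast
  next
    case noncrit: False
    show ?thesis
    proof (cases "cut_connected (\<lambda>x y. \<not> adj x y) W")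
      case True
      define \<chi> where "\<chi> = (LEAST k. colourable adj W k)"
      have "colourable adj W \<chi>"
        unfolding \<chi>_def by (rule LeastI, rule colourable_card[OF fin adj_irrefl])
      have least: "\<not> colourable adj W j \<longleftrightarrow> j < \<chi>" for j
        using \<open>colourable adj W \<chi>\<close> colourable_mono not_less_Least unfolding \<chi>_def by (metis not_le)
      have "\<not> colourable adj W 0" using less.prems(3) by (auto simp: colourable_def)
      then have pos: "0 < \<chi>" using least by blast
      have "colourable adj (W - {v}) (\<chi> - 1)" if v: "v \<in> W" for v
      proof -
        obtain j where "colourable adj (W - {v}) j" "\<not> colourable adj W j" using noncrit v by blast
        then show ?thesis using least[of j] pos by (elim colourable_mono) simp
      qed
      moreover have "\<not> colourable adj W (\<chi> - 1)" using least pos by simp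
      ultimately show ?thesis using reed_bound_critical[OF less.prems] True by blast
    next
      case False
      \<comment> \<open>A cut without non-edges presents the graph as the join of \<open>A\<close> and \<open>W - A\<close>.\<close>
      then obtain A where A: "A \<subset> W" "A \<noteq> {}" and join: "\<And>x y. x \<in> A \<Longrightarrow> y \<in> W - A \<Longrightarrow> adj x y"
        unfolding cut_connected_def by blast
      obtain v K where v: "v \<in> A" and K: "clique_in adj A K"
        and cA: "colourable adj A ((card {u \<in> A. adj v u} + card K + 2) div 2)" using IH[OF A] by blast
      obtain L where L: "clique_in adj (W - A) L"
        and cB: "colourable adj (W - A) ((card (W - A) + card L) div 2)"
        using colourable_half_card_plus_clique[of "W - A" adj] fin adj_sym adj_irrefl by blast
      have finA: "finite A" using A fin finite_subset by blast
      have "{u. adj v u} = {u \<in> A. adj v u} \<union> (W - A)"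
        using join[OF v] adj_verts2 by blast
      then have deg: "card {u. adj v u} = card {u \<in> A. adj v u} + card (W - A)"
        using fin finA by (simp add: card_Un_disjoint disjoint_iff)
      have KL: "card (K \<union> L) = card K + card L"
        by (rule card_Un_disjoint) (use K L finA fin in \<open>auto simp: clique_in_def intro: finite_subset\<close>)
      have union: "A \<union> (W - A) = W" using A by blast
      have sum: "colourable adj (A \<union> (W - A))
          ((card {u \<in> A. adj v u} + card K + 2) div 2 + (card (W - A) + card L) div 2)"
        by (rule colourable_Un[OF cA cB]) (rule adj_sym)
      have "(card {u \<in> A. adj v u} + card K + 2) div 2 + (card (W - A) + card L) div 2
          \<le> (card {u. adj v u} + card (K \<union> L) + 2) div 2"
        unfolding deg KL by linarith
      then have "colourable adj W ((card {u. adj v u} + card (K \<union> L) + 2) div 2)"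
        by (rule colourable_mono[OF sum[unfolded union]])
      moreover have "clique_in adj W (K \<union> L)"
        using K L A join adj_sym unfolding clique_in_def by blast
      ultimately show ?thesis using v A by blast
    qed
  qed
qed

section \<open>Transfer to pair graphs\<close>

text \<open>
  The isomorphism in \<open>contains_induced\<close> leads from the subgraph to \<open>F\<close>, so its witness is the inverse of
  the embedding \<open>h\<close>.
\<close>

lemma contains_inducedI:
  fixes G :: "'a pair_pre_digraph" and F :: "'b pair_pre_digraph" and h :: "'b \<Rightarrow> 'a"
  assumes "pair_graph G"
    and F: "parcs F \<subseteq> pverts F \<times> pverts F"
    and h: "inj_on h (pverts F)" "h ` pverts F \<subseteq> pverts G"
    and iff: "\<And>x y. x \<in> pverts F \<Longrightarrow> y \<in> pverts F \<Longrightarrow> (h x, h y) \<in> parcs G \<longleftrightarrow> (x, y) \<in> parcs F"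
  shows "contains_induced G F"
proof -
  interpret pair_graph G by fact
  let ?H = "with_proj G \<restriction> (h ` pverts F)"
  define g where "g = the_inv_into (pverts F) h"
  have gh: "g (h x) = x" if "x \<in> pverts F" for x
    using that h(1) by (simp add: g_def the_inv_into_f_f)
  define f :: "('a, 'a \<times> 'a, 'b, 'b \<times> 'b) digraph_isomorphism"
    where "f = \<lparr>iso_verts = g, iso_arcs = map_prod g g, iso_head = snd, iso_tail = fst\<rparr>"
  have arcs_H: "arcs ?H = map_prod h h ` parcs F"
  proof
    show "arcs ?H \<subseteq> map_prod h h ` parcs F"
    proof
      fix e assume "e \<in> arcs ?H"
      then obtain x y where "e = (h x, h y)" "(h x, h y) \<in> parcs G" "x \<in> pverts F" "y \<in> pverts F"
        by (cases e) auto
      then show "e \<in> map_prod h h ` parcs F" using iff by force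
    qed
    show "map_prod h h ` parcs F \<subseteq> arcs ?H" using F iff by auto
  qed
  have ind: "induced_subgraph ?H (with_proj G)"
    by (rule induced_induce) (use h(2) in simp)
  have wf: "wf_digraph ?H" using ind by blast
  have inj_g: "inj_on g (h ` pverts F)" using gh by (auto simp: inj_on_def)
  have "pre_digraph.digraph_isomorphism ?H f"
    unfolding pre_digraph.digraph_isomorphism_def
  proof (intro conjI ballI wf)
    show "inj_on (iso_verts f) (verts ?H)" using inj_g by (simp add: f_def)
    show "inj_on (iso_arcs f) (arcs ?H)"
      unfolding arcs_H f_def using gh F by (auto simp: inj_on_def subset_iff) 
  qed (simp_all add: f_def)
  moreover have "with_proj F = app_iso f ?H"
  proof -
    have "g ` h ` pverts F = pverts F" using gh by force
    moreover have "map_prod g g (map_prod h h e) = e" if "e \<in> parcs F" for e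
      using that gh F by (cases e) auto
    then have "map_prod g g ` map_prod h h ` parcs F = parcs F"
      unfolding image_image by simp
    then have "arcs (app_iso f ?H) = parcs F"
      unfolding arcs_app_iso arcs_H by (simp add: f_def)
    ultimately show ?thesis
      by (intro pre_digraph.equality) (simp_all add: f_def del: arcs_app_iso)
  qed
  ultimately show ?thesis using ind unfolding contains_induced_def digraph_iso_def by blast
qed

lemma P5_banner_free_graph_parcs:
  fixes G :: "'a pair_pre_digraph"
  assumes "pair_graph G" and "\<not> contains_induced G P5" and "\<not> contains_induced G banner"
  shows "P5_banner_free_graph (pverts G) (\<lambda>x y. (x, y) \<in> parcs G)"
proof -
  interpret pair_graph G by fact
  have sym: "(y, x) \<in> parcs G" if "(x, y) \<in> parcs G" for x y
    using pair_sym_arcs that by (auto simp: symmetric_def dest: symD)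
  have irrefl: "(x, x) \<notin> parcs G" for x using pair_no_loops by fastforce
  have verts: "x \<in> pverts G" "y \<in> pverts G" if "(x, y) \<in> parcs G" for x y
    using that wellformed' by blast+
  have five: "{0..<5} = {0, 1, 2, 3, 4 :: nat}" by auto
  show ?thesis
  proof
    fix a b c d e
    assume edges: "(a, b) \<in> parcs G" "(b, c) \<in> parcs G" "(c, d) \<in> parcs G" "(d, e) \<in> parcs G"
      and non: "(a, c) \<notin> parcs G" "(a, d) \<notin> parcs G" "(a, e) \<notin> parcs G" "(b, d) \<notin> parcs G"
        "(b, e) \<notin> parcs G" "(c, e) \<notin> parcs G"
    note all = edges non edges[THEN sym] irrefl
    have non': "(c, a) \<notin> parcs G" "(d, a) \<notin> parcs G" "(e, a) \<notin> parcs G" "(d, b) \<notin> parcs G"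
        "(e, b) \<notin> parcs G" "(e, c) \<notin> parcs G" using non sym by blast+
    have distinct: "distinct [a, b, c, d, e]" using all non' by auto
    have "contains_induced G P5"
    proof (rule contains_inducedI[where h = "\<lambda>i. [a, b, c, d, e] ! i"])
      show "inj_on (\<lambda>i. [a, b, c, d, e] ! i) (pverts P5)"
        using distinct inj_on_nth[of "[a, b, c, d, e]" "{0..<5}"] by (simp add: P5_def graph_of_edges_def)
      show "(\<lambda>i. [a, b, c, d, e] ! i) ` pverts P5 \<subseteq> pverts G"
        using edges[THEN verts(1)] edges[THEN verts(2)] by (simp add: P5_def graph_of_edges_def five)
      show "([a, b, c, d, e] ! x, [a, b, c, d, e] ! y) \<in> parcs G \<longleftrightarrow> (x, y) \<in> parcs P5"
        if "x \<in> pverts P5" "y \<in> pverts P5" for x y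
        using that all non' unfolding P5_def graph_of_edges_def pair_pre_digraph.simps five
        by (elim insertE emptyE; simp)
    qed (use assms(1) in \<open>auto simp: P5_def graph_of_edges_def\<close>)
    then show False using assms(2) by blast
  next
    fix a b c d e
    assume edges: "(a, b) \<in> parcs G" "(b, c) \<in> parcs G" "(c, d) \<in> parcs G" "(d, a) \<in> parcs G"
        "(a, e) \<in> parcs G"
      and "b \<noteq> d" and non: "(a, c) \<notin> parcs G" "(b, d) \<notin> parcs G" "(e, b) \<notin> parcs G"
        "(e, c) \<notin> parcs G" "(e, d) \<notin> parcs G"
    note all = edges non edges[THEN sym] irrefl
    have non': "(c, a) \<notin> parcs G" "(d, b) \<notin> parcs G" "(b, e) \<notin> parcs G"
        "(c, e) \<notin> parcs G" "(d, e) \<notin> parcs G" using non sym by blast+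
    have distinct: "distinct [a, b, c, d, e]" using all non' \<open>b \<noteq> d\<close> by auto
    have "contains_induced G banner"
    proof (rule contains_inducedI[where h = "\<lambda>i. [a, b, c, d, e] ! i"])
      show "inj_on (\<lambda>i. [a, b, c, d, e] ! i) (pverts banner)"
        using distinct inj_on_nth[of "[a, b, c, d, e]" "{0..<5}"] by (simp add: banner_def graph_of_edges_def)
      show "(\<lambda>i. [a, b, c, d, e] ! i) ` pverts banner \<subseteq> pverts G"
        using edges[THEN verts(1)] edges[THEN verts(2)] by (simp add: banner_def graph_of_edges_def five)
      show "([a, b, c, d, e] ! x, [a, b, c, d, e] ! y) \<in> parcs G \<longleftrightarrow> (x, y) \<in> parcs banner"
        if "x \<in> pverts banner" "y \<in> pverts banner" for x y
        using that all non' unfolding banner_def graph_of_edges_def pair_pre_digraph.simps five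
        by (elim insertE emptyE; simp)
    qed (use assms(1) in \<open>auto simp: banner_def graph_of_edges_def\<close>)
    then show False using assms(3) by blast
  qed (use sym irrefl verts in blast)+
qed

theorem corollary4:
  fixes G :: "'a pair_pre_digraph"
  assumes "pair_graph G"
    and "pverts G \<noteq> {}"
    and "\<not> contains_induced G P5"
    and "\<not> contains_induced G banner"
  shows "int (chromatic_number G) \<le>
           \<lceil>(real (max_degree G) + real (clique_number G) + 1) / 2\<rceil>"
proof -
  interpret pair_graph G by fact
  let ?adj = "\<lambda>x y. (x, y) \<in> parcs G"
  have fin: "finite (pverts G)" by (rule pair_finite_verts)
  obtain v K where v: "v \<in> pverts G" and K: "clique_in ?adj (pverts G) K"
    and c: "colourable ?adj (pverts G) ((card {u. ?adj v u} + card K + 2) div 2)"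
    using reed_bound[OF P5_banner_free_graph_parcs[OF assms(1,3,4)] fin assms(2)] by blast
  have "out_arcs (with_proj G) v = Pair v ` {u. ?adj v u}" by (auto simp: out_arcs_def)
  then have "out_degree (with_proj G) v = card {u. ?adj v u}"
    by (simp add: out_degree_def card_image inj_on_def)
  then have deg: "card {u. ?adj v u} \<le> max_degree G"
    unfolding max_degree_def using v fin by (metis Max_ge finite_imageI imageI)
  have "is_clique G K" using K unfolding clique_in_def is_clique_def by blast
  moreover have "finite {S. is_clique G S}"
    by (rule finite_subset[of _ "Pow (pverts G)"]) (auto simp: is_clique_def fin)
  ultimately have clique: "card K \<le> clique_number G"
    unfolding clique_number_def by (intro Max_ge) auto
  obtain col where "col ` pverts G \<subseteq> {..<(card {u. ?adj v u} + card K + 2) div 2}"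
    "\<forall>x\<in>pverts G. \<forall>y\<in>pverts G. ?adj x y \<longrightarrow> col x \<noteq> col y"
    using c by (auto simp: colourable_def)
  then have "proper_coloring G ((card {u. ?adj v u} + card K + 2) div 2) col"
    unfolding proper_coloring_def using wellformed' by blast
  then have "chromatic_number G \<le> (card {u. ?adj v u} + card K + 2) div 2"
    unfolding chromatic_number_def by (intro Least_le) blast
  then have "2 * chromatic_number G \<le> max_degree G + clique_number G + 2"
    using deg clique by linarith
  then show ?thesis by (simp add: le_ceiling_iff field_simps)
qed

end
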